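(* The following statements for a semiring $S$ are equivalent: (1) $S$ is a discrete valuation semiring; (2) $S$ is a principal ideal MC semiring possessing a unique maximal ideal $J\neq (0)$; (3) $S$ is a unique factorization semiring with a unique (up to associates) irreducible element $t$; (4) $S$ is a quasi-local MC semiring whose unique maximal ideal $J\neq (0)$ is principal and $\bigcap_{n=1}^{\infty}J^n=(0)$; (5) $S$ is a quasi-local MC semiring which satisfies ACCP and whose unique maximal ideal $J\neq (0)$ is principal; (6) $S$ is an MC semiring and there exists a nonzero and nonunit element $t\in S$ such that any nonzero ideal $I$ of $S$ is of the form $I=(t^n)$ for some $n\geq 0$.
   Context: All semirings are commutative, with a zero $0$ (absorbing for multiplication) and an identity $1\neq 0$. A semifield is such a semiring in which every nonzero element is multiplicatively invertible. An ideal of $S$ is a nonempty subset closed under addition and under multiplication by elements of $S$; maximal ideals are maximal among proper ideals; an ideal is principal if it is of the form $(a)=\{sa:s\in S\}$; $J^n$ is the usual $n$-th power of the ideal $J$ (all finite sums of products of $n$ elements of $J$). A prime ideal is an ideal $P\neq S$ such that $ab\in P$ implies $a\in P$ or $b\in P$. $S$ is MC (multiplicatively cancellative) if $ab=ac$ and $a\neq 0$ imply $b=c$. $S$ is quasi-local if it has exactly one maximal ideal. $S$ is a principal ideal semiring if every ideal of $S$ is principal. $S$ satisfies ACCP if every ascending chain of principal ideals of $S$ is stationary. $U(S)$ denotes the set of units of $S$. Elements $a,b$ are associates if $a=ub$ for some $u\in U(S)$. A nonzero nonunit $s\in S$ is irreducible if $s=s_1s_2$ with $s_1,s_2\in S$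 implies that $s_1$ or $s_2$ is a unit. An element $p\in S\setminus\{1\}$ is prime if the principal ideal $(p)$ is a prime ideal. A unique factorization semiring is an MC semiring $S$ such that each irreducible element of $S$ is a prime element, and any nonzero nonunit element of $S$ is a product of irreducible elements. Let $\mathbb{Z}_\infty=\mathbb{Z}\cup\{+\infty\}$ with the usual order and addition, with $+\infty$ greatest and absorbing for addition. A discrete valuation on a semiring $K$ is a map $v:K\to\mathbb{Z}_\infty$ such that $v(xy)=v(x)+v(y)$ and $v(x+y)\geq\min\{v(x),v(y)\}$ for all $x,y\in K$, $v(1)=0$ and $v(0)=+\infty$. $S$ is a discrete valuation semiring if there exist a semifield $K$ containing $S$ as a subsemiring and a surjective discrete valuation $v:K\to\mathbb{Z}_\infty$ with $S=\{s\in K: v(s)\geq 0\}$. *)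

theory Defs
  imports "HOL-Algebra.Ring" "HOL-Library.Extended"
begin

locale nontrivial_comm_semiring = semiring R + comm_monoid R for R (structure) +
  assumes one_neq_zero: "\<one> \<noteq> \<zero>"

locale semifield = nontrivial_comm_semiring R for R (structure) +
  assumes nonzero_Units: "carrier R - {\<zero>} \<subseteq> Units R"

section \<open>Ideals\<close>

text \<open>The ideals of HOL-Algebra are additive subgroups and thus do not make sense in a
  semiring.\<close>

definition semiring_ideal :: "('a, 'm) ring_scheme \<Rightarrow> 'a set \<Rightarrow> bool" where
  "semiring_ideal S I \<longleftrightarrow> I \<subseteq> carrier S \<and> I \<noteq> {} \<and>
     (\<forall>a\<in>I. \<forall>b\<in>I. a \<oplus>\<^bsub>S\<^esub> b \<in> I) \<and> (\<forall>s\<in>carrier S. \<forall>a\<in>I. s \<otimes>\<^bsub>S\<^esub> a \<in> I)"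

definition semiring_maximal_ideal :: "('a, 'm) ring_scheme \<Rightarrow> 'a set \<Rightarrow> bool" where
  "semiring_maximal_ideal S J \<longleftrightarrow> semiring_ideal S J \<and> J \<noteq> carrier S \<and>
     (\<forall>I. semiring_ideal S I \<and> I \<noteq> carrier S \<and> J \<subseteq> I \<longrightarrow> I = J)"

definition semiring_prime_ideal :: "('a, 'm) ring_scheme \<Rightarrow> 'a set \<Rightarrow> bool" where
  "semiring_prime_ideal S P \<longleftrightarrow> semiring_ideal S P \<and> P \<noteq> carrier S \<and>
     (\<forall>a\<in>carrier S. \<forall>b\<in>carrier S. a \<otimes>\<^bsub>S\<^esub> b \<in> P \<longrightarrow> a \<in> P \<or> b \<in> P)"

definition generated_by :: "('a, 'm) ring_scheme \<Rightarrow> 'a \<Rightarrow> 'a set" where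
  "generated_by S a = {s \<otimes>\<^bsub>S\<^esub> a | s. s \<in> carrier S}"

definition semiring_principal :: "('a, 'm) ring_scheme \<Rightarrow> 'a set \<Rightarrow> bool" where
  "semiring_principal S I \<longleftrightarrow> (\<exists>a\<in>carrier S. I = generated_by S a)"

text \<open>Only exponents \<open>n \<ge> 1\<close> are meaningful: for \<open>n = 0\<close> this formula yields the multiples
  of \<open>\<one>\<close> instead of the whole semiring.  The empty sum (\<open>m = 0\<close>) adds nothing new, because
  \<open>\<zero>\<close> lies in every ideal.\<close>

definition semiring_ideal_power :: "('a, 'm) ring_scheme \<Rightarrow> 'a set \<Rightarrow> nat \<Rightarrow> 'a set" where
  "semiring_ideal_power S J n =
     {finsum S (\<lambda>i. finprod S (a i) {..<n}) {..<m} | (m :: nat) (a :: nat \<Rightarrow> nat \<Rightarrow> 'a).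
        \<forall>i<m. \<forall>j<n. a i j \<in> J}"

section \<open>Classes of semirings\<close>

definition mult_cancellative :: "('a, 'm) ring_scheme \<Rightarrow> bool" where
  "mult_cancellative S \<longleftrightarrow> (\<forall>a\<in>carrier S. \<forall>b\<in>carrier S. \<forall>c\<in>carrier S.
     a \<otimes>\<^bsub>S\<^esub> b = a \<otimes>\<^bsub>S\<^esub> c \<and> a \<noteq> \<zero>\<^bsub>S\<^esub> \<longrightarrow> b = c)"

definition quasi_local :: "('a, 'm) ring_scheme \<Rightarrow> bool" where
  "quasi_local S \<longleftrightarrow> (\<exists>!J. semiring_maximal_ideal S J)"

definition principal_ideal_semiring :: "('a, 'm) ring_scheme \<Rightarrow> bool" where
  "principal_ideal_semiring S \<longleftrightarrow> (\<forall>I. semiring_ideal S I \<longrightarrow> semiring_principal S I)"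

definition ACCP :: "('a, 'm) ring_scheme \<Rightarrow> bool" where
  "ACCP S \<longleftrightarrow> (\<forall>I :: nat \<Rightarrow> 'a set.
     (\<forall>n. semiring_principal S (I n)) \<and> (\<forall>n. I n \<subseteq> I (Suc n)) \<longrightarrow>
     (\<exists>N. \<forall>n\<ge>N. I n = I N))"

definition semiring_associates :: "('a, 'm) ring_scheme \<Rightarrow> 'a \<Rightarrow> 'a \<Rightarrow> bool" where
  "semiring_associates S a b \<longleftrightarrow> (\<exists>u\<in>Units S. a = u \<otimes>\<^bsub>S\<^esub> b)"

definition semiring_irreducible :: "('a, 'm) ring_scheme \<Rightarrow> 'a \<Rightarrow> bool" where
  "semiring_irreducible S s \<longleftrightarrow> s \<in> carrier S \<and> s \<noteq> \<zero>\<^bsub>S\<^esub> \<and> s \<notin> Units S \<and>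
     (\<forall>s1\<in>carrier S. \<forall>s2\<in>carrier S. s = s1 \<otimes>\<^bsub>S\<^esub> s2 \<longrightarrow> s1 \<in> Units S \<or> s2 \<in> Units S)"

definition semiring_prime :: "('a, 'm) ring_scheme \<Rightarrow> 'a \<Rightarrow> bool" where
  "semiring_prime S p \<longleftrightarrow> p \<in> carrier S \<and> p \<noteq> \<one>\<^bsub>S\<^esub> \<and> semiring_prime_ideal S (generated_by S p)"

definition unique_factorization_semiring :: "('a, 'm) ring_scheme \<Rightarrow> bool" where
  "unique_factorization_semiring S \<longleftrightarrow> mult_cancellative S \<and>
     (\<forall>q. semiring_irreducible S q \<longrightarrow> semiring_prime S q) \<and>
     (\<forall>s\<in>carrier S. s \<noteq> \<zero>\<^bsub>S\<^esub> \<and> s \<notin> Units S \<longrightarrow>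
        (\<exists>(n :: nat) q. (\<forall>i<n. semiring_irreducible S (q i)) \<and> s = finprod S q {..<n}))"

section \<open>Discrete valuations\<close>

text \<open>The ordered monoid of integers with \<open>+\<infinity>\<close> is the part of \<^typ>\<open>int extended\<close>
  without \<^const>\<open>Minf\<close>.\<close>

definition Z_inf :: "int extended set" where
  "Z_inf = insert Pinf (range Fin)"

definition discrete_valuation :: "('k, 'm) ring_scheme \<Rightarrow> ('k \<Rightarrow> int extended) \<Rightarrow> bool" where
  "discrete_valuation K v \<longleftrightarrow> v \<in> carrier K \<rightarrow> Z_inf \<and>
     (\<forall>x\<in>carrier K. \<forall>y\<in>carrier K.
        v (x \<otimes>\<^bsub>K\<^esub> y) = v x + v y \<and> min (v x) (v y) \<le> v (x \<oplus>\<^bsub>K\<^esub> y)) \<and>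
     v \<one>\<^bsub>K\<^esub> = 0 \<and> v \<zero>\<^bsub>K\<^esub> = Pinf"

definition semiring_embedding ::
    "('a, 'm) ring_scheme \<Rightarrow> ('k, 'n) ring_scheme \<Rightarrow> ('a \<Rightarrow> 'k) \<Rightarrow> bool" where
  "semiring_embedding S K f \<longleftrightarrow> f \<in> ring_hom S K \<and> f \<zero>\<^bsub>S\<^esub> = \<zero>\<^bsub>K\<^esub> \<and> inj_on f (carrier S)"

text \<open>\<open>K\<close> contains \<open>S\<close>, via the embedding \<open>f\<close>, as the subsemiring of the elements of
  nonnegative value.\<close>

definition valuation_semiring_of ::
    "('a, 'm) ring_scheme \<Rightarrow> ('k, 'n) ring_scheme \<Rightarrow> ('a \<Rightarrow> 'k) \<Rightarrow> ('k \<Rightarrow> int extended) \<Rightarrow> bool" where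
  "valuation_semiring_of S K f v \<longleftrightarrow> semifield K \<and> semiring_embedding S K f \<and>
     discrete_valuation K v \<and> v ` carrier K = Z_inf \<and>
     f ` carrier S = {x \<in> carrier K. 0 \<le> v x}"

text \<open>HOL cannot quantify existentially over the type of the elements of \<open>K\<close>.  Using pairs of
  elements of \<open>S\<close> for this type is no restriction: every element of \<open>K\<close> lies in the image of
  \<open>S\<close> or has its inverse there.  This is proved in \<open>discrete_valuation_semiringI\<close> below, where
  the type of the elements of \<open>K\<close> is arbitrary.\<close>

definition discrete_valuation_semiring :: "('a, 'm) ring_scheme \<Rightarrow> bool" where
  "discrete_valuation_semiring S \<longleftrightarrow>
     (\<exists>(K :: ('a \<times> 'a) ring) f v. valuation_semiring_of S K f v)"

lemma semifield_transport:
  fixes K :: "('k, 'n) ring_scheme" and g :: "'k \<Rightarrow> 'b" and h :: "'b \<Rightarrow> 'k"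
  assumes K: "semifield K" and hg: "\<And>x. x \<in> carrier K \<Longrightarrow> h (g x) = x"
  shows "semifield \<lparr>carrier = g ` carrier K, mult = (\<lambda>x y. g (h x \<otimes>\<^bsub>K\<^esub> h y)), one = g \<one>\<^bsub>K\<^esub>,
           zero = g \<zero>\<^bsub>K\<^esub>, add = (\<lambda>x y. g (h x \<oplus>\<^bsub>K\<^esub> h y))\<rparr>" (is "semifield ?L")
proof -
  interpret K: semifield K by (rule K)
  have eq: "g x = g y \<longleftrightarrow> x = y" if "x \<in> carrier K" "y \<in> carrier K" for x y
    using hg[OF that(1)] hg[OF that(2)] by metis
  have "abelian_monoid ?L"
    by (rule abelian_monoidI) (auto simp: hg K.a_assoc intro!: arg_cong[of _ _ g] K.a_comm)
  moreover have "comm_monoid ?L"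
    by (rule comm_monoidI) (auto simp: hg K.m_assoc intro!: arg_cong[of _ _ g] K.m_comm)
  ultimately have "nontrivial_comm_semiring ?L"
    unfolding nontrivial_comm_semiring_def semiring_def semiring_axioms_def
      nontrivial_comm_semiring_axioms_def
    by (auto simp: hg eq K.l_distr K.r_distr K.one_neq_zero comm_monoid.axioms(1))
  moreover have "y \<in> Units ?L" if y: "y \<in> carrier ?L - {\<zero>\<^bsub>?L\<^esub>}" for y
  proof -
    obtain x where x: "x \<in> carrier K" "y = g x" "x \<noteq> \<zero>\<^bsub>K\<^esub>" using y by auto
    then have "x \<in> Units K" using K.nonzero_Units by auto
    then obtain z where "z \<in> carrier K" "z \<otimes>\<^bsub>K\<^esub> x = \<one>\<^bsub>K\<^esub>" "x \<otimes>\<^bsub>K\<^esub> z = \<one>\<^bsub>K\<^esub>"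
      by (auto simp: Units_def)
    then show ?thesis using x by (auto simp: Units_def hg intro!: bexI[of _ z])
  qed
  ultimately show ?thesis
    unfolding semifield_def semifield_axioms_def by blast
qed

lemma discrete_valuation_semiringI:
  fixes S :: "('a, 'm) ring_scheme" and K :: "('k, 'n) ring_scheme"
  assumes "nontrivial_comm_semiring S" and val: "valuation_semiring_of S K f v"
  shows "discrete_valuation_semiring S"
proof -
  interpret S: nontrivial_comm_semiring S by (rule assms(1))
  interpret K: semifield K using val by (simp add: valuation_semiring_of_def)
  have emb: "f \<in> ring_hom S K" "f \<zero>\<^bsub>S\<^esub> = \<zero>\<^bsub>K\<^esub>" "inj_on f (carrier S)"
    and dv: "discrete_valuation K v" and surj: "v ` carrier K = Z_inf"
    and img: "f ` carrier S = {x \<in> carrier K. 0 \<le> v x}"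
    using val by (auto simp: valuation_semiring_of_def semiring_embedding_def)
  define i where "i = inv_into (carrier S) f"
  have i: "i x \<in> carrier S" "f (i x) = x" if "x \<in> f ` carrier S" for x
    using that by (auto simp: i_def inv_into_into f_inv_into_f)
  have inv_closed: "inv\<^bsub>K\<^esub> x \<in> f ` carrier S" "x \<in> Units K"
    if x: "x \<in> carrier K" "x \<notin> f ` carrier S" for x
  proof -
    have "x \<noteq> \<zero>\<^bsub>K\<^esub>" using emb(2) x(2) by (metis S.zero_closed image_eqI)
    then show u: "x \<in> Units K" using K.nonzero_Units x by auto
    have "v x + v (inv\<^bsub>K\<^esub> x) = 0"
      using dv u by (metis K.Units_closed K.Units_inv_closed K.Units_r_inv discrete_valuation_def)
    moreover have "\<not> 0 \<le> v x" using x img by auto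
    ultimately have "0 \<le> v (inv\<^bsub>K\<^esub> x)"
      by (cases "v x"; cases "v (inv\<^bsub>K\<^esub> x)") (auto simp: zero_extended_def)
    then show "inv\<^bsub>K\<^esub> x \<in> f ` carrier S" using u img by auto
  qed
  define g where "g x = (if x \<in> f ` carrier S then (i x, \<one>\<^bsub>S\<^esub>) else (\<zero>\<^bsub>S\<^esub>, i (inv\<^bsub>K\<^esub> x)))" for x
  have f1: "f \<one>\<^bsub>S\<^esub> = \<one>\<^bsub>K\<^esub>" using emb(1) by (simp add: ring_hom_def)
  have ninv: "i (inv\<^bsub>K\<^esub> x) \<noteq> \<one>\<^bsub>S\<^esub>" if x: "x \<in> carrier K" "x \<notin> f ` carrier S" for x
  proof
    assume "i (inv\<^bsub>K\<^esub> x) = \<one>\<^bsub>S\<^esub>"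
    then have "inv\<^bsub>K\<^esub> x = \<one>\<^bsub>K\<^esub>" using i(2)[OF inv_closed(1)[OF x]] f1 by simp
    then have "x = \<one>\<^bsub>K\<^esub>" using inv_closed(2)[OF x]
      by (metis K.Units_inv_inv K.inv_one)
    then show False using x f1 by (metis S.one_closed image_eqI)
  qed
  have inj: "inj_on g (carrier K)"
  proof (rule inj_onI)
    fix x y assume xy: "x \<in> carrier K" "y \<in> carrier K" "g x = g y"
    consider "x \<in> f ` carrier S" "y \<in> f ` carrier S" | "x \<notin> f ` carrier S" "y \<notin> f ` carrier S"
      using xy ninv by (auto simp: g_def split: if_splits)
    then show "x = y"
    proof cases
      case 1 then show ?thesis using xy(3) i(2) by (metis (no_types) g_def prod.inject)
    next
      case 2
      then have "inv\<^bsub>K\<^esub> x = inv\<^bsub>K\<^esub> y"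
        using xy i(2) inv_closed(1) by (metis (no_types) g_def prod.inject)
      then show ?thesis using 2 xy inv_closed(2) by (metis K.Units_inv_inv)
    qed
  qed
  define h where "h = inv_into (carrier K) g"
  have hg: "h (g x) = x" if "x \<in> carrier K" for x
    using that inj by (simp add: h_def)
  have eq: "g x = g y \<longleftrightarrow> x = y" if "x \<in> carrier K" "y \<in> carrier K" for x y
    using hg[OF that(1)] hg[OF that(2)] by metis
  define L :: "('a \<times> 'a) ring" where
    "L = \<lparr>carrier = g ` carrier K, mult = (\<lambda>x y. g (h x \<otimes>\<^bsub>K\<^esub> h y)), one = g \<one>\<^bsub>K\<^esub>,
           zero = g \<zero>\<^bsub>K\<^esub>, add = (\<lambda>x y. g (h x \<oplus>\<^bsub>K\<^esub> h y))\<rparr>"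
  have fc: "f x \<in> carrier K" if "x \<in> carrier S" for x
    using emb(1) that by (auto simp: ring_hom_def)
  have "semifield L" unfolding L_def
    by (rule semifield_transport) (simp_all add: K.semifield_axioms hg)
  moreover have "semiring_embedding S L (g \<circ> f)"
    using emb unfolding semiring_embedding_def L_def ring_hom_def inj_on_def
    by (auto simp: hg eq fc)
  moreover have "discrete_valuation L (v \<circ> h)"
    using dv unfolding discrete_valuation_def L_def by (auto simp: hg)
  moreover have "(v \<circ> h) ` carrier L = Z_inf"
  proof -
    have "(v \<circ> h) ` carrier L = v ` carrier K" by (force simp: L_def hg image_iff)
    then show ?thesis using surj by simp
  qed
  moreover have "(g \<circ> f) ` carrier S = {x \<in> carrier L. 0 \<le> (v \<circ> h) x}"
  proof -
    have "(g \<circ> f) ` carrier S = g ` {x \<in> carrier K. 0 \<le> v x}" by (simp only: image_comp[symmetric] img)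
    also have "\<dots> = {x \<in> carrier L. 0 \<le> (v \<circ> h) x}" by (auto simp: L_def hg)
    finally show ?thesis .
  qed
  ultimately have "valuation_semiring_of S L (g \<circ> f) (v \<circ> h)"
    unfolding valuation_semiring_of_def by blast
  then show ?thesis unfolding discrete_valuation_semiring_def by blast
qed

end

theory Submission
  imports Defs
begin

text \<open>Each of the six conditions amounts to the existence of a uniformizer: a nonzero nonunit \<open>t\<close> of
  a cancellative semiring such that every nonzero element is a unit times a power of \<open>t\<close>.  The exponent
  is then unique and defines an order function.  It turns products into sums, and \<open>b\<close> divides
  \<open>a\<close> exactly if the order of \<open>b\<close> is at most that of \<open>a\<close>.

  From a uniformizer all conditions are read off the order.  A nonzero ideal is generated by any of its
  elements of least order, so it is a power of \<open>(t)\<close> (\<open>nonzero_ideal_eq_power\<close>); the nonunits are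
  the elements of \<open>(t)\<close>, which is therefore the only maximal ideal (\<open>maximal_ideal_iff\<close>); the
  irreducible elements are those of order one (\<open>irreducible_iff_ord\<close>); and ACCP follows from the
  principality of all ideals.  For the valuation, a cancellative semiring has a semifield of fractions,
  to which the order extends as the difference of the orders of numerator and denominator.  The
  inequality for sums holds because the multiples of \<open>t [^] k\<close> are closed under addition, and the
  fractions of nonnegative value are those whose denominator divides the numerator.

  In the other direction the task is to divide a given nonzero element by \<open>t\<close> until a unit is left.
  For a discrete valuation semiring, \<open>t\<close> is any element of value one.  For a principal maximal ideal
  \<open>(t)\<close>, Zorn's lemma puts every nonunit into the only maximal ideal, so the division can go on as long
  as the quotient is a nonunit; it must end if no nonzero element is divisible by all powers of \<open>t\<close>.  That
  property is the intersection condition (\<open>ideal_power_generated_by\<close>) and follows from ACCP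
  (\<open>ACCP_imp_separated\<close>), and the condition on principal ideal semirings implies the one with ACCP.
  If the nonzero ideals are the \<open>(t [^] n)\<close>, or if \<open>t\<close> is the only irreducible element up to
  associates, the normal form results from comparing generators or from multiplying out a
  factorization.\<close>

section \<open>Ideals of a commutative semiring\<close>

context nontrivial_comm_semiring
begin

lemma mem_generated_by: "x \<in> generated_by R a \<longleftrightarrow> (\<exists>s\<in>carrier R. x = s \<otimes> a)"
  by (auto simp: generated_by_def)

lemma self_in_generated_by: "a \<in> carrier R \<Longrightarrow> a \<in> generated_by R a"
  by (auto simp: mem_generated_by intro!: bexI[of _ \<one>])

lemma semiring_ideal_generated_by:
  assumes a: "a \<in> carrier R"
  shows "semiring_ideal R (generated_by R a)"
  unfolding semiring_ideal_def
proof (intro conjI ballI)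
  show "generated_by R a \<subseteq> carrier R" using a by (auto simp: mem_generated_by)
  show "generated_by R a \<noteq> {}" using self_in_generated_by[OF a] by auto
next
  fix x y assume "x \<in> generated_by R a" "y \<in> generated_by R a"
  then obtain r s where "r \<in> carrier R" "s \<in> carrier R" "x = r \<otimes> a" "y = s \<otimes> a"
    by (auto simp: mem_generated_by)
  then show "x \<oplus> y \<in> generated_by R a"
    using a by (auto simp: mem_generated_by l_distr intro!: bexI[of _ "r \<oplus> s"])
next
  fix r x assume "r \<in> carrier R" "x \<in> generated_by R a"
  then show "r \<otimes> x \<in> generated_by R a"
    using a by (auto simp: mem_generated_by m_assoc[symmetric])
qed

lemma semiring_idealD:
  assumes "semiring_ideal R I"
  shows "I \<subseteq> carrier R"
    and "a \<in> I \<Longrightarrow> b \<in> I \<Longrightarrow> a \<oplus> b \<in> I"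
    and "s \<in> carrier R \<Longrightarrow> a \<in> I \<Longrightarrow> s \<otimes> a \<in> I"
    and "\<zero> \<in> I"
proof -
  show *: "I \<subseteq> carrier R" "a \<in> I \<Longrightarrow> b \<in> I \<Longrightarrow> a \<oplus> b \<in> I"
    "s \<in> carrier R \<Longrightarrow> a \<in> I \<Longrightarrow> s \<otimes> a \<in> I" for a b s
    using assms by (auto simp: semiring_ideal_def)
  obtain a where "a \<in> I" using assms by (auto simp: semiring_ideal_def)
  then show "\<zero> \<in> I" using *(1) *(3)[of \<zero> a] by (auto simp: subset_iff)
qed

lemma generated_by_subset:
  "semiring_ideal R I \<Longrightarrow> a \<in> I \<Longrightarrow> generated_by R a \<subseteq> I"
  by (auto simp: mem_generated_by semiring_idealD)

lemma generated_by_zero: "generated_by R \<zero> = {\<zero>}"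
  by (auto simp: mem_generated_by intro!: exI[of _ \<zero>])

lemma ideal_eq_carrier_iff:
  assumes I: "semiring_ideal R I"
  shows "I = carrier R \<longleftrightarrow> \<one> \<in> I"
proof
  assume "\<one> \<in> I"
  then have "s \<in> I" if "s \<in> carrier R" for s
    using semiring_idealD(3)[OF I that] that by force
  then show "I = carrier R" using semiring_idealD(1)[OF I] by blast
qed auto

lemma proper_ideal_no_Units:
  assumes I: "semiring_ideal R I" and proper: "I \<noteq> carrier R" and "a \<in> I"
  shows "a \<notin> Units R"
proof
  assume "a \<in> Units R"
  then have "inv a \<otimes> a = \<one>" "inv a \<in> carrier R" by auto
  then have "\<one> \<in> I" using semiring_idealD(3)[OF I] \<open>a \<in> I\<close> by metis
  then show False using ideal_eq_carrier_iff[OF I] proper by simp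
qed

lemma Units_left_factor:
  assumes "a \<otimes> b \<in> Units R" "a \<in> carrier R" "b \<in> carrier R"
  shows "a \<in> Units R"
proof -
  let ?c = "b \<otimes> inv (a \<otimes> b)"
  have "a \<otimes> ?c = \<one>" "?c \<in> carrier R"
    using assms by (simp_all add: m_assoc[symmetric])
  then show ?thesis using assms(2) by (auto simp: Units_def m_comm intro!: bexI[of _ ?c])
qed

lemma generated_by_proper_iff:
  assumes "a \<in> carrier R"
  shows "generated_by R a \<noteq> carrier R \<longleftrightarrow> a \<notin> Units R"
proof -
  have "\<one> \<in> generated_by R a \<longleftrightarrow> a \<in> Units R"
  proof
    assume "\<one> \<in> generated_by R a"
    then obtain s where s: "s \<in> carrier R" "\<one> = s \<otimes> a"
      unfolding mem_generated_by by blast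
    then have "a \<otimes> s \<in> Units R" using m_comm[OF assms s(1)] Units_one_closed by metis
    then show "a \<in> Units R" using Units_left_factor assms s(1) by blast
  next
    assume "a \<in> Units R"
    then have "inv a \<in> carrier R" "\<one> = inv a \<otimes> a" by simp_all
    then show "\<one> \<in> generated_by R a" unfolding mem_generated_by by blast
  qed
  then show ?thesis using ideal_eq_carrier_iff[OF semiring_ideal_generated_by[OF assms]] by simp
qed

text \<open>Any two elements of the union lie in a common member of the chain.  This serves both Zorn's
  lemma and the passage from principal ideals to ACCP.\<close>

lemma semiring_ideal_chain_Union:
  assumes "C \<noteq> {}" and "\<And>I. I \<in> C \<Longrightarrow> semiring_ideal R I"
    and chain: "\<And>I J. I \<in> C \<Longrightarrow> J \<in> C \<Longrightarrow> I \<subseteq> J \<or> J \<subseteq> I"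
  shows "semiring_ideal R (\<Union>C)"
  unfolding semiring_ideal_def
proof (intro conjI ballI)
  show "\<Union>C \<subseteq> carrier R" using assms(2) semiring_idealD(1) by blast
  show "\<Union>C \<noteq> {}" using assms(1,2) semiring_idealD(4) by blast
next
  fix a b assume "a \<in> \<Union>C" "b \<in> \<Union>C"
  then obtain I J where IJ: "I \<in> C" "J \<in> C" "a \<in> I" "b \<in> J" by auto
  from chain[OF IJ(1,2)] show "a \<oplus> b \<in> \<Union>C"
    using IJ semiring_idealD(2)[OF assms(2)] by (meson UnionI subsetD)
next
  fix s a assume "s \<in> carrier R" "a \<in> \<Union>C"
  then show "s \<otimes> a \<in> \<Union>C" using semiring_idealD(3)[OF assms(2)] by blast
qed

lemma proper_ideal_in_maximal:
  assumes I: "semiring_ideal R I" "I \<noteq> carrier R"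
  obtains J where "semiring_maximal_ideal R J" "I \<subseteq> J"
proof -
  let ?A = "{K. semiring_ideal R K \<and> \<one> \<notin> K \<and> I \<subseteq> K}"
  have "\<exists>M\<in>?A. \<forall>X\<in>?A. M \<subseteq> X \<longrightarrow> X = M"
  proof (rule subset_Zorn_nonempty)
    show "?A \<noteq> {}" using I ideal_eq_carrier_iff by blast
  next
    fix C assume C: "C \<noteq> {}" "subset.chain ?A C"
    have "semiring_ideal R (\<Union>C)"
      using C by (intro semiring_ideal_chain_Union) (auto simp: subset_chain_def)
    then show "\<Union>C \<in> ?A" using C by (auto simp: subset_chain_def)
  qed
  then obtain M where "M \<in> ?A" and max: "\<forall>X\<in>?A. M \<subseteq> X \<longrightarrow> X = M" ..
  then have M: "semiring_ideal R M" "\<one> \<notin> M" "I \<subseteq> M" by simp_all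
  have "semiring_maximal_ideal R M"
    unfolding semiring_maximal_ideal_def
  proof (intro conjI allI impI)
    show "M \<noteq> carrier R" using M(2) by auto
  next
    fix K assume "semiring_ideal R K \<and> K \<noteq> carrier R \<and> M \<subseteq> K"
    then show "K = M" using max M(3) ideal_eq_carrier_iff[of K] by auto
  qed (rule M(1))
  then show ?thesis using M(3) that by blast
qed

lemma nonunit_in_unique_maximal:
  assumes J: "\<And>I. semiring_maximal_ideal R I \<Longrightarrow> I = J" and a: "a \<in> carrier R" "a \<notin> Units R"
  shows "a \<in> J"
proof -
  have "generated_by R a \<noteq> carrier R" using generated_by_proper_iff[OF a(1)] a(2) by simp
  with semiring_ideal_generated_by[OF a(1)]
  obtain M where "semiring_maximal_ideal R M" "generated_by R a \<subseteq> M"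
    by (rule proper_ideal_in_maximal)
  then show ?thesis using J self_in_generated_by[OF a(1)] by auto
qed

lemma principal_ideal_semiring_ACCP:
  assumes "principal_ideal_semiring R"
  shows "ACCP R"
  unfolding ACCP_def
proof (intro allI impI, elim conjE)
  fix I :: "nat \<Rightarrow> 'a set"
  assume pr: "\<forall>n. semiring_principal R (I n)" and inc: "\<forall>n. I n \<subseteq> I (Suc n)"
  have mono: "I m \<subseteq> I n" if "m \<le> n" for m n
    using lift_Suc_mono_le[of I m n] inc that by blast
  have ideal: "semiring_ideal R (I n)" for n
  proof -
    obtain a where "a \<in> carrier R" "I n = generated_by R a"
      using pr unfolding semiring_principal_def by blast
    then show ?thesis using semiring_ideal_generated_by by simp
  qed
  have "I m \<subseteq> I n \<or> I n \<subseteq> I m" for m n using mono by (cases "m \<le> n") auto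
  then have "semiring_ideal R (\<Union>(range I))"
    using ideal by (intro semiring_ideal_chain_Union) auto
  then obtain a where a: "a \<in> carrier R" "\<Union>(range I) = generated_by R a"
    using assms unfolding principal_ideal_semiring_def semiring_principal_def by blast
  \<comment> \<open>The generator of the union already lies in some member of the chain.\<close>
  have "a \<in> \<Union>(range I)" unfolding a(2) by (rule self_in_generated_by[OF a(1)])
  then obtain N where "a \<in> I N" by auto
  then have "\<Union>(range I) \<subseteq> I N" using a(2) generated_by_subset[OF ideal] by simp
  then have "I n = I N" if "n \<ge> N" for n using mono[OF that] by (simp add: UN_subset_iff subset_antisym)
  then show "\<exists>N. \<forall>n\<ge>N. I n = I N" by blast
qed

lemma finsum_in_ideal:
  assumes I: "semiring_ideal R I" and "\<And>i. i < m \<Longrightarrow> f i \<in> I"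
  shows "finsum R f {..<m::nat} \<in> I"
  using assms(2)
proof (induction m)
  case 0 then show ?case using semiring_idealD(4)[OF I] by simp
next
  case (Suc m)
  have "f \<in> {..<Suc m} \<rightarrow> carrier R" using Suc.prems semiring_idealD(1)[OF I] by auto
  then have "finsum R f {..<Suc m} = f m \<oplus> finsum R f {..<m}"
    by (simp add: lessThan_Suc Pi_def)
  then show ?case using Suc semiring_idealD(2)[OF I] by simp
qed

lemma finprod_in_generated_pow:
  assumes t: "t \<in> carrier R" and "\<And>j. j < n \<Longrightarrow> f j \<in> generated_by R t"
  shows "finprod R f {..<n::nat} \<in> generated_by R (t [^] n)"
  using assms(2)
proof (induction n)
  case 0 then show ?case by (auto simp: mem_generated_by)
next
  case (Suc n)
  have "f \<in> {..<Suc n} \<rightarrow> carrier R"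
    using Suc.prems semiring_idealD(1)[OF semiring_ideal_generated_by[OF t]] by auto
  then have eq: "finprod R f {..<Suc n} = f n \<otimes> finprod R f {..<n}"
    by (simp add: lessThan_Suc Pi_def)
  obtain r s where "r \<in> carrier R" "s \<in> carrier R" "f n = r \<otimes> t"
    "finprod R f {..<n} = s \<otimes> t [^] n"
    using Suc by (force simp: mem_generated_by)
  then show ?case unfolding eq using t
    by (auto simp: mem_generated_by m_ac intro!: bexI[of _ "r \<otimes> s"])
qed

lemma finprod_first_factor_replaced:
  assumes "a \<in> carrier R" "t \<in> carrier R"
  shows "finprod R (\<lambda>j. if j = 0 then a else t) {..<Suc n} = a \<otimes> t [^] n"
proof (induction n)
  case (Suc n)
  have "finprod R (\<lambda>j. if j = 0 then a else t) {..<Suc (Suc n)}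
      = t \<otimes> finprod R (\<lambda>j. if j = 0 then a else t) {..<Suc n}"
    using assms by (subst lessThan_Suc, subst finprod_insert) auto
  then show ?case using Suc assms by (simp add: m_ac)
qed (use assms in \<open>simp add: lessThan_Suc\<close>)

text \<open>A product of \<open>n\<close> multiples of \<open>t\<close> is a multiple of \<open>t [^] n\<close>, and so is a sum of such
  products; conversely a multiple of \<open>t [^] n\<close> is itself one such product.\<close>

lemma ideal_power_generated_by:
  assumes t: "t \<in> carrier R" and "n \<ge> 1"
  shows "semiring_ideal_power R (generated_by R t) n = generated_by R (t [^] n)"
proof
  show "semiring_ideal_power R (generated_by R t) n \<subseteq> generated_by R (t [^] n)"
    using t by (auto simp: semiring_ideal_power_def semiring_ideal_generated_by
        intro!: finsum_in_ideal finprod_in_generated_pow)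
  show "generated_by R (t [^] n) \<subseteq> semiring_ideal_power R (generated_by R t) n"
  proof
    fix x assume "x \<in> generated_by R (t [^] n)"
    then obtain r where r: "r \<in> carrier R" "x = r \<otimes> t [^] n" by (auto simp: mem_generated_by)
    obtain k where n: "n = Suc k" using assms(2) by (cases n) auto
    \<comment> \<open>The coefficient is absorbed into the first of the \<open>n\<close> factors.\<close>
    define a :: "nat \<Rightarrow> nat \<Rightarrow> 'a" where "a i j = (if j = 0 then r \<otimes> t else t)" for i j
    have "finprod R (a 0) {..<n} = x"
      using finprod_first_factor_replaced[of "r \<otimes> t" t k] r t by (simp add: n a_def[abs_def] m_ac)
    then have "x = finsum R (\<lambda>i. finprod R (a i) {..<n}) {..<1}"
      using r t by (simp add: lessThan_Suc)
    moreover have "\<forall>i<1. \<forall>j<n. a i j \<in> generated_by R t"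
      using r t self_in_generated_by by (auto simp: a_def mem_generated_by)
    ultimately show "x \<in> semiring_ideal_power R (generated_by R t) n"
      unfolding semiring_ideal_power_def by blast
  qed
qed

end

section \<open>Cancellative semirings and their fractions\<close>

locale mc_semiring = nontrivial_comm_semiring R for R (structure) +
  assumes mult_cancellative: "mult_cancellative R"
begin

declare Units_closed [simp]

lemma m_lcancel [simp]:
  "a \<in> carrier R \<Longrightarrow> b \<in> carrier R \<Longrightarrow> c \<in> carrier R \<Longrightarrow> a \<noteq> \<zero> \<Longrightarrow> a \<otimes> b = a \<otimes> c \<longleftrightarrow> b = c"
  using mult_cancellative unfolding mult_cancellative_def by blast

lemma m_rcancel:
  "a \<in> carrier R \<Longrightarrow> b \<in> carrier R \<Longrightarrow> c \<in> carrier R \<Longrightarrow> a \<noteq> \<zero> \<Longrightarrow> b \<otimes> a = c \<otimes> a \<longleftrightarrow> b = c"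
  using m_lcancel m_comm by metis

lemma integral_iff [simp]:
  assumes "a \<in> carrier R" "b \<in> carrier R"
  shows "a \<otimes> b = \<zero> \<longleftrightarrow> a = \<zero> \<or> b = \<zero>"
  using m_lcancel[of a b \<zero>] assms by auto

lemma pow_nonzero:
  "a \<in> carrier R \<Longrightarrow> a \<noteq> \<zero> \<Longrightarrow> a [^] (n::nat) \<noteq> \<zero>"
  by (induction n) (auto simp: one_neq_zero)

lemma Units_nonzero: "u \<in> Units R \<Longrightarrow> u \<noteq> \<zero>"
  using Units_r_inv one_neq_zero Units_inv_closed l_null by metis

text \<open>A fraction is the set of all pairs that represent it.  The operations of the semifield use the
  pair chosen by \<open>num\<close> and \<open>den\<close>; the lemmas \<open>mult_frac\<close> and \<open>add_frac\<close> show that any other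
  choice has the same result.\<close>

definition frac :: "'a \<Rightarrow> 'a \<Rightarrow> ('a \<times> 'a) set" where
  "frac a b = {(c, d). c \<in> carrier R \<and> d \<in> carrier R - {\<zero>} \<and> a \<otimes> d = c \<otimes> b}"

definition fractions :: "('a \<times> 'a) set set" where
  "fractions = {frac a b | a b. a \<in> carrier R \<and> b \<in> carrier R - {\<zero>}}"

definition num :: "('a \<times> 'a) set \<Rightarrow> 'a" where "num X = fst (SOME p. p \<in> X)"

definition den :: "('a \<times> 'a) set \<Rightarrow> 'a" where "den X = snd (SOME p. p \<in> X)"

definition fraction_semifield :: "('a \<times> 'a) set ring" where
  "fraction_semifield = \<lparr>carrier = fractions,
     mult = (\<lambda>X Y. frac (num X \<otimes> num Y) (den X \<otimes> den Y)), one = frac \<one> \<one>,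
     zero = frac \<zero> \<one>,
     add = (\<lambda>X Y. frac (num X \<otimes> den Y \<oplus> num Y \<otimes> den X) (den X \<otimes> den Y))\<rparr>"

lemma frac_eq_iff:
  assumes "a \<in> carrier R" "b \<in> carrier R" "b \<noteq> \<zero>" "c \<in> carrier R" "d \<in> carrier R" "d \<noteq> \<zero>"
  shows "frac a b = frac c d \<longleftrightarrow> a \<otimes> d = c \<otimes> b"
proof
  assume "frac a b = frac c d"
  moreover have "(c, d) \<in> frac c d" using assms by (auto simp: frac_def)
  ultimately show "a \<otimes> d = c \<otimes> b" by (auto simp: frac_def)
next
  have "frac a b \<subseteq> frac c d"
    if "a \<in> carrier R" "b \<in> carrier R" "b \<noteq> \<zero>" "c \<in> carrier R" "d \<in> carrier R" "d \<noteq> \<zero>"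
      and eq: "a \<otimes> d = c \<otimes> b" for a b c d
  proof
    fix p assume "p \<in> frac a b"
    then obtain x y where p: "p = (x, y)" "x \<in> carrier R" "y \<in> carrier R" "y \<noteq> \<zero>"
      "a \<otimes> y = x \<otimes> b" by (auto simp: frac_def)
    have "b \<otimes> (c \<otimes> y) = (c \<otimes> b) \<otimes> y" using that p by (simp add: m_ac)
    also have "\<dots> = (a \<otimes> y) \<otimes> d"
      unfolding eq[symmetric] using that(1-6) p(2-4) by (simp add: m_ac)
    also have "\<dots> = b \<otimes> (x \<otimes> d)" unfolding p(5) using that(1-6) p(2-4) by (simp add: m_ac)
    finally show "p \<in> frac c d" using that p by (auto simp: frac_def)
  qed
  then show "a \<otimes> d = c \<otimes> b \<Longrightarrow> frac a b = frac c d" using assms by (metis subset_antisym)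
qed

lemma num_den_frac:
  assumes "a \<in> carrier R" "b \<in> carrier R" "b \<noteq> \<zero>"
  shows "num (frac a b) \<in> carrier R" "den (frac a b) \<in> carrier R" "den (frac a b) \<noteq> \<zero>"
    "num (frac a b) \<otimes> b = a \<otimes> den (frac a b)"
proof -
  have "(a, b) \<in> frac a b" using assms by (auto simp: frac_def)
  then have "(SOME p. p \<in> frac a b) \<in> frac a b" by (rule someI)
  then show "num (frac a b) \<in> carrier R" "den (frac a b) \<in> carrier R" "den (frac a b) \<noteq> \<zero>"
    "num (frac a b) \<otimes> b = a \<otimes> den (frac a b)"
    by (auto simp: num_def den_def frac_def)
qed

lemma mult_frac:
  assumes ab: "a \<in> carrier R" "b \<in> carrier R" "b \<noteq> \<zero>" and cd: "c \<in> carrier R" "d \<in> carrier R" "d \<noteq> \<zero>"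
  shows "frac a b \<otimes>\<^bsub>fraction_semifield\<^esub> frac c d = frac (a \<otimes> c) (b \<otimes> d)"
proof -
  define a' b' c' d' where "a' = num (frac a b)" "b' = den (frac a b)"
    "c' = num (frac c d)" "d' = den (frac c d)"
  note 1 = num_den_frac[OF ab, folded a'_b'_c'_d'_def]
  note 2 = num_den_frac[OF cd, folded a'_b'_c'_d'_def]
  have "(a' \<otimes> c') \<otimes> (b \<otimes> d) = (a' \<otimes> b) \<otimes> (c' \<otimes> d)" using 1(1-3) 2(1-3) ab cd by (simp add: m_ac)
  also have "\<dots> = (a \<otimes> c) \<otimes> (b' \<otimes> d')" unfolding 1(4) 2(4) using 1(1-3) 2(1-3) ab cd by (simp add: m_ac)
  finally have "frac (a' \<otimes> c') (b' \<otimes> d') = frac (a \<otimes> c) (b \<otimes> d)"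
    using 1 2 ab cd by (subst frac_eq_iff) auto
  then show ?thesis by (simp add: fraction_semifield_def a'_b'_c'_d'_def)
qed

lemma add_frac:
  assumes ab: "a \<in> carrier R" "b \<in> carrier R" "b \<noteq> \<zero>" and cd: "c \<in> carrier R" "d \<in> carrier R" "d \<noteq> \<zero>"
  shows "frac a b \<oplus>\<^bsub>fraction_semifield\<^esub> frac c d = frac (a \<otimes> d \<oplus> c \<otimes> b) (b \<otimes> d)"
proof -
  define a' b' c' d' where "a' = num (frac a b)" "b' = den (frac a b)"
    "c' = num (frac c d)" "d' = den (frac c d)"
  note 1 = num_den_frac[OF ab, folded a'_b'_c'_d'_def]
  note 2 = num_den_frac[OF cd, folded a'_b'_c'_d'_def]
  have "(a' \<otimes> d' \<oplus> c' \<otimes> b') \<otimes> (b \<otimes> d) = (a' \<otimes> b) \<otimes> (d' \<otimes> d) \<oplus> (c' \<otimes> d) \<otimes> (b' \<otimes> b)"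
    using 1(1-3) 2(1-3) ab cd by (simp add: l_distr r_distr m_ac)
  also have "\<dots> = (a \<otimes> d \<oplus> c \<otimes> b) \<otimes> (b' \<otimes> d')"
    unfolding 1(4) 2(4) using 1(1-3) 2(1-3) ab cd by (simp add: l_distr r_distr m_ac)
  finally have "frac (a' \<otimes> d' \<oplus> c' \<otimes> b') (b' \<otimes> d') = frac (a \<otimes> d \<oplus> c \<otimes> b) (b \<otimes> d)"
    using 1 2 ab cd by (subst frac_eq_iff) auto
  then show ?thesis by (simp add: fraction_semifield_def a'_b'_c'_d'_def)
qed

lemma one_frac: "\<one>\<^bsub>fraction_semifield\<^esub> = frac \<one> \<one>"
  and zero_frac: "\<zero>\<^bsub>fraction_semifield\<^esub> = frac \<zero> \<one>"
  by (simp_all add: fraction_semifield_def)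

lemma frac_cases:
  assumes "X \<in> carrier fraction_semifield"
  obtains a b where "a \<in> carrier R" "b \<in> carrier R" "b \<noteq> \<zero>" "X = frac a b"
  using assms by (auto simp: fraction_semifield_def fractions_def)

lemma frac_closed:
  "a \<in> carrier R \<Longrightarrow> b \<in> carrier R \<Longrightarrow> b \<noteq> \<zero> \<Longrightarrow> frac a b \<in> carrier fraction_semifield"
  by (auto simp: fraction_semifield_def fractions_def)

lemmas frac_simps = mult_frac add_frac one_frac zero_frac frac_closed frac_eq_iff one_neq_zero

lemma abelian_monoid_fractions: "abelian_monoid fraction_semifield"
proof (rule abelian_monoidI, goal_cases)
  case (1 x y) then show ?case by (auto elim!: frac_cases simp: frac_simps)
next
  case 2 then show ?case by (simp add: frac_simps)
next
  case (3 x y z) then show ?case by (auto elim!: frac_cases simp: frac_simps l_distr r_distr m_ac a_ac)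
next
  case (4 x) then show ?case by (auto elim!: frac_cases simp: frac_simps)
next
  case (5 x y) then show ?case by (auto elim!: frac_cases simp: frac_simps l_distr r_distr m_ac a_ac)
qed

lemma comm_monoid_fractions: "comm_monoid fraction_semifield"
proof (rule comm_monoidI, goal_cases)
  case (1 x y) then show ?case by (auto elim!: frac_cases simp: frac_simps)
next
  case 2 then show ?case by (simp add: frac_simps)
next
  case (3 x y z) then show ?case by (auto elim!: frac_cases simp: frac_simps m_ac)
next
  case (4 x) then show ?case by (auto elim!: frac_cases simp: frac_simps)
next
  case (5 x y) then show ?case by (auto elim!: frac_cases simp: frac_simps m_ac)
qed

lemma semifield_fractions: "semifield fraction_semifield"
proof -
  interpret K: comm_monoid fraction_semifield by (rule comm_monoid_fractions)
  have distr: "(x \<oplus>\<^bsub>fraction_semifield\<^esub> y) \<otimes>\<^bsub>fraction_semifield\<^esub> z =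
      x \<otimes>\<^bsub>fraction_semifield\<^esub> z \<oplus>\<^bsub>fraction_semifield\<^esub> y \<otimes>\<^bsub>fraction_semifield\<^esub> z"
    if "x \<in> carrier fraction_semifield" "y \<in> carrier fraction_semifield"
      "z \<in> carrier fraction_semifield" for x y z
    using that by (elim frac_cases) (simp add: frac_simps l_distr r_distr m_ac)
  moreover have "z \<otimes>\<^bsub>fraction_semifield\<^esub> (x \<oplus>\<^bsub>fraction_semifield\<^esub> y) =
      z \<otimes>\<^bsub>fraction_semifield\<^esub> x \<oplus>\<^bsub>fraction_semifield\<^esub> z \<otimes>\<^bsub>fraction_semifield\<^esub> y"
    if "x \<in> carrier fraction_semifield" "y \<in> carrier fraction_semifield"
      "z \<in> carrier fraction_semifield" for x y z
    using distr[OF that] that abelian_monoid.a_closed[OF abelian_monoid_fractions]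
    by (simp add: K.m_comm[of z])
  moreover have null: "\<zero>\<^bsub>fraction_semifield\<^esub> \<otimes>\<^bsub>fraction_semifield\<^esub> x = \<zero>\<^bsub>fraction_semifield\<^esub>"
    "x \<otimes>\<^bsub>fraction_semifield\<^esub> \<zero>\<^bsub>fraction_semifield\<^esub> = \<zero>\<^bsub>fraction_semifield\<^esub>"
    if "x \<in> carrier fraction_semifield" for x
    using that by (elim frac_cases; simp add: frac_simps)+
  ultimately have "semiring fraction_semifield"
    using abelian_monoid_fractions K.monoid_axioms
    by (simp add: semiring_def semiring_axioms_def)
  moreover have "\<one>\<^bsub>fraction_semifield\<^esub> \<noteq> \<zero>\<^bsub>fraction_semifield\<^esub>" by (simp add: frac_simps)
  moreover have "X \<in> Units fraction_semifield"
    if "X \<in> carrier fraction_semifield - {\<zero>\<^bsub>fraction_semifield\<^esub>}" for X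
  proof -
    have "X \<in> carrier fraction_semifield" using that by simp
    then obtain a b where ab: "a \<in> carrier R" "b \<in> carrier R" "b \<noteq> \<zero>" "X = frac a b"
      by (rule frac_cases)
    then have "a \<noteq> \<zero>" using that by (auto simp: frac_simps)
    with ab have "frac b a \<in> carrier fraction_semifield"
      "frac a b \<otimes>\<^bsub>fraction_semifield\<^esub> frac b a = \<one>\<^bsub>fraction_semifield\<^esub>"
      "frac b a \<otimes>\<^bsub>fraction_semifield\<^esub> frac a b = \<one>\<^bsub>fraction_semifield\<^esub>"
      by (simp_all add: frac_simps m_comm[of b a])
    then show ?thesis using ab(4) that unfolding Units_def by blast
  qed
  ultimately show ?thesis
    using K.comm_monoid_axioms
    by (auto simp: semifield_def semifield_axioms_def nontrivial_comm_semiring_def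
        nontrivial_comm_semiring_axioms_def)
qed

lemma embedding_fractions: "semiring_embedding R fraction_semifield (\<lambda>s. frac s \<one>)"
  by (auto simp: semiring_embedding_def ring_hom_def inj_on_def frac_simps)

end

section \<open>Uniformizers\<close>

text \<open>This multiplicative normal form is the hub of the equivalence: each of the six conditions
  says that some \<open>t\<close> has these properties.  Addition does not occur in it; the bound for the order of
  a sum is a consequence of distributivity.\<close>

locale uniformizer = mc_semiring R for R (structure) +
  fixes t
  assumes t_closed [simp]: "t \<in> carrier R" and t_nonzero [simp]: "t \<noteq> \<zero>"
    and t_nonunit: "t \<notin> Units R"
    and factor: "a \<in> carrier R \<Longrightarrow> a \<noteq> \<zero> \<Longrightarrow> \<exists>u\<in>Units R. \<exists>n::nat. a = u \<otimes> t [^] n"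
begin

lemma pow_t_nonzero [simp]: "t [^] (n::nat) \<noteq> \<zero>"
  by (rule pow_nonzero) simp_all

text \<open>Otherwise cancelling \<open>t [^] m\<close> would leave \<open>t\<close> as a factor of the unit \<open>u\<close>.\<close>

lemma exponent_le:
  assumes "u \<in> Units R" "s \<in> carrier R" "u \<otimes> t [^] (m::nat) = s \<otimes> t [^] (n::nat)"
  shows "n \<le> m"
proof (rule ccontr)
  assume "\<not> n \<le> m"
  then obtain k where n: "n = Suc (m + k)" using less_imp_Suc_add by (metis not_le)
  have "s \<otimes> t [^] n = (t \<otimes> (s \<otimes> t [^] k)) \<otimes> t [^] m"
    using assms(2) by (simp add: n nat_pow_mult[symmetric] m_ac)
  then have "u = t \<otimes> (s \<otimes> t [^] k)"
    using assms m_rcancel[of "t [^] m" u "t \<otimes> (s \<otimes> t [^] k)"] by simp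
  then show False using assms t_nonunit Units_left_factor[of t "s \<otimes> t [^] k"] by simp
qed

definition ord :: "'a \<Rightarrow> nat" where
  "ord a = (THE n. \<exists>u\<in>Units R. a = u \<otimes> t [^] n)"

lemma ord_eqI:
  assumes u: "u \<in> Units R"
  shows "ord (u \<otimes> t [^] n) = n"
  unfolding ord_def
proof (rule the_equality)
  fix m :: nat assume "\<exists>w\<in>Units R. u \<otimes> t [^] n = w \<otimes> t [^] m"
  then obtain w where "w \<in> Units R" "u \<otimes> t [^] n = w \<otimes> t [^] m" by blast
  then show "m = n" using exponent_le[OF u, of w n m] exponent_le[of w u m n] u by simp
qed (use u in blast)

lemma ord_factor:
  assumes "a \<in> carrier R" "a \<noteq> \<zero>"
  obtains u where "u \<in> Units R" "a = u \<otimes> t [^] ord a"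
proof -
  obtain u n where "u \<in> Units R" "a = u \<otimes> t [^] (n::nat)" using factor[OF assms] by blast
  then show ?thesis using that[of u] ord_eqI[of u n] by metis
qed

lemma ord_mult:
  assumes "a \<in> carrier R" "a \<noteq> \<zero>" "b \<in> carrier R" "b \<noteq> \<zero>"
  shows "ord (a \<otimes> b) = ord a + ord b"
proof -
  obtain u where u: "u \<in> Units R" "a = u \<otimes> t [^] ord a" using ord_factor assms by blast
  obtain w where w: "w \<in> Units R" "b = w \<otimes> t [^] ord b" using ord_factor assms by blast
  have "a \<otimes> b = (u \<otimes> t [^] ord a) \<otimes> (w \<otimes> t [^] ord b)" by (simp flip: u(2) w(2))
  also have "\<dots> = (u \<otimes> w) \<otimes> t [^] (ord a + ord b)"
    using u(1) w(1) by (simp add: nat_pow_mult[symmetric] m_ac)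
  finally show ?thesis using ord_eqI[of "u \<otimes> w"] u(1) w(1) by simp
qed

lemma ord_pow_t [simp]: "ord (t [^] (n::nat)) = n"
  using ord_eqI[OF Units_one_closed, of n] by simp

lemma divides_iff_ord:
  assumes a: "a \<in> carrier R" "a \<noteq> \<zero>" and b: "b \<in> carrier R" "b \<noteq> \<zero>"
  shows "a \<in> generated_by R b \<longleftrightarrow> ord b \<le> ord a"
proof
  assume "a \<in> generated_by R b"
  then obtain s where s: "s \<in> carrier R" "a = s \<otimes> b" unfolding mem_generated_by by blast
  then have "s \<noteq> \<zero>" using a(2) b(1) by auto
  then show "ord b \<le> ord a" using s ord_mult[of s b] b by simp
next
  assume "ord b \<le> ord a"
  then obtain k where k: "ord a = ord b + k" using le_Suc_ex by blast
  obtain u where u: "u \<in> Units R" "a = u \<otimes> t [^] ord a" using ord_factor a by blast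
  obtain w where w: "w \<in> Units R" "b = w \<otimes> t [^] ord b" using ord_factor b by blast
  have "(u \<otimes> inv w \<otimes> t [^] k) \<otimes> b = (u \<otimes> inv w \<otimes> t [^] k) \<otimes> (w \<otimes> t [^] ord b)"
    by (simp flip: w(2))
  also have "\<dots> = (inv w \<otimes> w) \<otimes> (u \<otimes> t [^] (ord b + k))"
    using u(1) w(1) by (simp add: nat_pow_mult[symmetric] m_ac del: Units_l_inv Units_r_inv)
  also have "\<dots> = a" using u w(1) k by simp
  finally have "a = (u \<otimes> inv w \<otimes> t [^] k) \<otimes> b" by (rule sym)
  moreover have "u \<otimes> inv w \<otimes> t [^] k \<in> carrier R" using u(1) w(1) by simp
  ultimately show "a \<in> generated_by R b" unfolding mem_generated_by by blast
qed

text \<open>The ultrametric inequality holds because the elements of order at least \<open>k\<close>, together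
  with zero, form the ideal generated by \<open>t [^] k\<close>.\<close>

lemma ord_add:
  assumes a: "a \<in> carrier R" "a \<noteq> \<zero>" and b: "b \<in> carrier R" "b \<noteq> \<zero>" and "a \<oplus> b \<noteq> \<zero>"
  shows "min (ord a) (ord b) \<le> ord (a \<oplus> b)"
proof -
  define k where "k = min (ord a) (ord b)"
  have "a \<in> generated_by R (t [^] k)" "b \<in> generated_by R (t [^] k)"
    using a b by (simp_all add: divides_iff_ord k_def)
  then have "a \<oplus> b \<in> generated_by R (t [^] k)"
    by (intro semiring_idealD(2)[OF semiring_ideal_generated_by]) simp_all
  then show ?thesis using assms by (simp add: divides_iff_ord k_def)
qed

lemma Units_iff_ord:
  assumes "a \<in> carrier R" "a \<noteq> \<zero>"
  shows "a \<in> Units R \<longleftrightarrow> ord a = 0"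
proof
  assume "a \<in> Units R"
  then show "ord a = 0" using ord_eqI[of a 0] assms(1) by simp
next
  assume "ord a = 0"
  moreover obtain u where "u \<in> Units R" "a = u \<otimes> t [^] ord a" using ord_factor assms by blast
  ultimately show "a \<in> Units R" by simp
qed

lemma nonunits_eq: "generated_by R t = carrier R - Units R"
proof -
  have "a \<in> generated_by R t \<longleftrightarrow> a \<notin> Units R" if "a \<in> carrier R" for a
  proof (cases "a = \<zero>")
    case True
    then show ?thesis
      using Units_nonzero semiring_idealD(4)[OF semiring_ideal_generated_by] by auto
  next
    case False
    then show ?thesis
      using divides_iff_ord[of a t] ord_pow_t[of 1] Units_iff_ord[of a] that by auto
  qed
  moreover have "generated_by R t \<subseteq> carrier R"
    using semiring_idealD(1)[OF semiring_ideal_generated_by] by simp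
  ultimately show ?thesis by blast
qed

lemma maximal_ideal_iff: "semiring_maximal_ideal R I \<longleftrightarrow> I = generated_by R t"
proof -
  have ideal: "semiring_ideal R (generated_by R t)" by (simp add: semiring_ideal_generated_by)
  have proper: "generated_by R t \<noteq> carrier R" using generated_by_proper_iff t_nonunit by simp
  have sub: "I \<subseteq> generated_by R t" if "semiring_ideal R I" "I \<noteq> carrier R" for I
    using proper_ideal_no_Units[OF that] semiring_idealD(1)[OF that(1)] nonunits_eq by blast
  show ?thesis
    unfolding semiring_maximal_ideal_def using ideal proper sub by blast
qed

lemma generated_by_t_nonzero: "generated_by R t \<noteq> {\<zero>}"
  using self_in_generated_by[OF t_closed] by auto

lemma nonzero_ideal_eq_power:
  assumes I: "semiring_ideal R I" and "I \<noteq> {\<zero>}"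
  shows "\<exists>n::nat. I = generated_by R (t [^] n)"
proof -
  obtain a where a: "a \<in> I" "a \<noteq> \<zero>" using assms semiring_idealD(4)[OF I] by blast
  \<comment> \<open>An element of least order divides all the others.\<close>
  define P where "P = (\<lambda>b. b \<in> I \<and> b \<noteq> \<zero>)"
  have "P (arg_min ord P) \<and> (\<forall>b. P b \<longrightarrow> ord (arg_min ord P) \<le> ord b)"
    by (rule arg_min_nat_lemma[of P a]) (simp add: P_def a)
  then obtain b where b: "b \<in> I" "b \<noteq> \<zero>" "\<And>c. c \<in> I \<Longrightarrow> c \<noteq> \<zero> \<Longrightarrow> ord b \<le> ord c"
    unfolding P_def by blast
  have bc: "b \<in> carrier R" using b(1) semiring_idealD(1)[OF I] by blast
  have "t [^] ord b \<in> generated_by R b" using bc b(2) by (simp add: divides_iff_ord)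
  then have pow: "t [^] ord b \<in> I" using generated_by_subset[OF I b(1)] by blast
  have "c \<in> generated_by R (t [^] ord b)" if "c \<in> I" for c
  proof (cases "c = \<zero>")
    case True
    then show ?thesis using semiring_idealD(4)[OF semiring_ideal_generated_by] by simp
  next
    case False
    moreover have "c \<in> carrier R" using that semiring_idealD(1)[OF I] by blast
    ultimately show ?thesis using b(3)[OF that] by (simp add: divides_iff_ord)
  qed
  then show ?thesis using generated_by_subset[OF I pow] by blast
qed

lemma principal_ideals: "principal_ideal_semiring R"
  unfolding principal_ideal_semiring_def semiring_principal_def
proof (intro allI impI)
  fix I assume "semiring_ideal R I"
  then show "\<exists>a\<in>carrier R. I = generated_by R a"
    using nonzero_ideal_eq_power[of I] generated_by_zero nat_pow_closed[OF t_closed] zero_closed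
    by metis
qed

lemma Inter_powers:
  "(\<Inter>n\<in>{1..}. semiring_ideal_power R (generated_by R t) n) = {\<zero>}"
proof -
  have "a = \<zero>" if "\<And>n::nat. n \<ge> 1 \<Longrightarrow> a \<in> generated_by R (t [^] n)" for a
  proof (rule ccontr)
    assume "a \<noteq> \<zero>"
    have a: "a \<in> generated_by R (t [^] Suc (ord a))" by (rule that) simp
    then have "a \<in> carrier R"
      using semiring_idealD(1)[OF semiring_ideal_generated_by[OF nat_pow_closed[OF t_closed]]]
      by (rule subsetD[rotated])
    then show False using a \<open>a \<noteq> \<zero>\<close> divides_iff_ord[of a "t [^] Suc (ord a)"] ord_pow_t
      by (metis nat_pow_closed not_less_eq_eq order_refl pow_t_nonzero t_closed)
  qed
  moreover have "\<zero> \<in> generated_by R (t [^] n)" for n :: nat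
    using semiring_idealD(4)[OF semiring_ideal_generated_by] by simp
  ultimately show ?thesis using ideal_power_generated_by[OF t_closed] by auto
qed

text \<open>Orders add up in a product, and the units are the elements of order zero, so irreducibility is
  the irreducibility of the order in the additive monoid of natural numbers.\<close>

lemma irreducible_iff_ord:
  assumes s: "s \<in> carrier R" "s \<noteq> \<zero>"
  shows "semiring_irreducible R s \<longleftrightarrow> ord s = 1"
proof
  assume irr: "semiring_irreducible R s"
  then have "ord s \<noteq> 0" using Units_iff_ord[OF s] by (simp add: semiring_irreducible_def)
  then obtain k where k: "ord s = Suc k" using not0_implies_Suc by blast
  obtain u where u: "u \<in> Units R" "s = u \<otimes> t [^] ord s" using ord_factor s by blast
  have eq: "s = (u \<otimes> t [^] k) \<otimes> t" using u k by (simp add: m_assoc)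
  have split: "a \<in> Units R \<or> b \<in> Units R"
    if "a \<in> carrier R" "b \<in> carrier R" "s = a \<otimes> b" for a b
    using irr that unfolding semiring_irreducible_def by blast
  have "u \<otimes> t [^] k \<in> Units R"
    using split[OF _ t_closed eq] u(1) t_nonunit by simp
  then have "ord (u \<otimes> t [^] k) = 0"
    using Units_iff_ord[OF Units_closed Units_nonzero] by blast
  then have "k = 0" using ord_eqI[OF u(1), of k] by simp
  then show "ord s = 1" using k by simp
next
  assume s1: "ord s = 1"
  show "semiring_irreducible R s"
    unfolding semiring_irreducible_def
  proof (intro conjI ballI impI)
    fix a b assume ab: "a \<in> carrier R" "b \<in> carrier R" "s = a \<otimes> b"
    then have nz: "a \<noteq> \<zero>" "b \<noteq> \<zero>" using s(2) by auto
    then have "ord a + ord b = 1" using ab s1 ord_mult by simp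
    then have "ord a = 0 \<or> ord b = 0" by linarith
    then show "a \<in> Units R \<or> b \<in> Units R"
      using ab(1,2) nz Units_iff_ord by blast
  qed (use s s1 Units_iff_ord in auto)
qed

lemma associates_t:
  assumes "semiring_irreducible R s"
  shows "semiring_associates R s t"
proof -
  have s: "s \<in> carrier R" "s \<noteq> \<zero>" using assms by (auto simp: semiring_irreducible_def)
  obtain u where "u \<in> Units R" "s = u \<otimes> t [^] ord s" using ord_factor s by blast
  moreover have "ord s = 1" using irreducible_iff_ord[OF s] assms by simp
  ultimately show ?thesis by (auto simp: semiring_associates_def)
qed

text \<open>An irreducible element generates the maximal ideal, and the complement of that ideal, the
  group of units, is closed under multiplication.\<close>

lemma irreducible_imp_prime:
  assumes "semiring_irreducible R s"
  shows "semiring_prime R s"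
proof -
  have s: "s \<in> carrier R" "s \<noteq> \<zero>" "s \<notin> Units R"
    using assms by (auto simp: semiring_irreducible_def)
  have "ord s = 1" using irreducible_iff_ord[OF s(1,2)] assms by simp
  then have "s \<in> generated_by R t" "t \<in> generated_by R s"
    using divides_iff_ord[of s t] divides_iff_ord[of t s] ord_pow_t[of 1] s by auto
  then have gen: "generated_by R s = carrier R - Units R"
    using nonunits_eq generated_by_subset[OF semiring_ideal_generated_by] s(1) t_closed
    by (metis subset_antisym)
  show ?thesis
    unfolding semiring_prime_def semiring_prime_ideal_def
    using s semiring_ideal_generated_by[OF s(1)] Units_m_closed Units_one_closed gen by auto
qed

lemma unique_factorization: "unique_factorization_semiring R"
  unfolding unique_factorization_semiring_def
proof (intro conjI allI impI ballI)
  fix s assume s: "s \<in> carrier R" "s \<noteq> \<zero> \<and> s \<notin> Units R"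
  then have "ord s \<noteq> 0" using Units_iff_ord by blast
  then obtain k where k: "ord s = Suc k" using not0_implies_Suc by blast
  obtain u where u: "u \<in> Units R" "s = u \<otimes> t [^] ord s" using ord_factor s by blast
  \<comment> \<open>The unit is absorbed into the first of the irreducible factors.\<close>
  define q where "q = (\<lambda>i::nat. if i = 0 then u \<otimes> t else t)"
  have "u \<otimes> t \<in> carrier R" "u \<otimes> t \<noteq> \<zero>" "ord (u \<otimes> t) = 1" "ord t = 1"
    using ord_eqI[OF u(1), of 1] ord_pow_t[of 1] u(1) Units_nonzero by auto
  then have "\<forall>i<Suc k. semiring_irreducible R (q i)"
    using irreducible_iff_ord by (simp add: q_def)
  moreover have "s = finprod R q {..<Suc k}"
    using finprod_first_factor_replaced[of "u \<otimes> t" t k] u k by (simp add: q_def m_ac)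
  ultimately show "\<exists>(n::nat) q. (\<forall>i<n. semiring_irreducible R (q i)) \<and> s = finprod R q {..<n}"
    by blast
qed (use mult_cancellative irreducible_imp_prime in blast)+

text \<open>The value of a fraction is read off the chosen representative; by \<open>val_frac\<close> below, every other
  representative gives the same value.\<close>

definition val :: "('a \<times> 'a) set \<Rightarrow> int extended" where
  "val X = (if num X = \<zero> then Pinf else Fin (int (ord (num X)) - int (ord (den X))))"

lemma val_frac:
  assumes "a \<in> carrier R" "b \<in> carrier R" "b \<noteq> \<zero>"
  shows "val (frac a b) = (if a = \<zero> then Pinf else Fin (int (ord a) - int (ord b)))"
proof -
  note nd = num_den_frac[OF assms]
  have "num (frac a b) = \<zero> \<longleftrightarrow> a = \<zero>"
    using nd assms integral_iff by metis
  moreover have "ord (num (frac a b)) + ord b = ord a + ord (den (frac a b))"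
    if "num (frac a b) \<noteq> \<zero>" "a \<noteq> \<zero>"
    using nd that assms ord_mult by metis
  ultimately show ?thesis by (auto simp: val_def)
qed

lemma val_add:
  assumes "a \<in> carrier R" "b \<in> carrier R" "b \<noteq> \<zero>" "c \<in> carrier R" "d \<in> carrier R" "d \<noteq> \<zero>"
  shows "min (val (frac a b)) (val (frac c d)) \<le> val (frac (a \<otimes> d \<oplus> c \<otimes> b) (b \<otimes> d))"
proof -
  consider "a = \<zero>" | "c = \<zero>" | "a \<otimes> d \<oplus> c \<otimes> b = \<zero>"
    | "a \<noteq> \<zero>" "c \<noteq> \<zero>" "a \<otimes> d \<oplus> c \<otimes> b \<noteq> \<zero>" by blast
  then show ?thesis
  proof cases
    case 4
    then have "min (ord (a \<otimes> d)) (ord (c \<otimes> b)) \<le> ord (a \<otimes> d \<oplus> c \<otimes> b)"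
      using assms by (intro ord_add) auto
    then show ?thesis using 4 assms by (auto simp: val_frac ord_mult min_def split: if_splits)
  qed (use assms in \<open>auto simp: val_frac ord_mult min_def\<close>)
qed

lemma valuation_fractions: "discrete_valuation fraction_semifield val"
  unfolding discrete_valuation_def
proof (intro conjI ballI)
  show "val \<in> carrier fraction_semifield \<rightarrow> Z_inf" by (auto simp: val_def Z_inf_def)
  show "val \<one>\<^bsub>fraction_semifield\<^esub> = 0" "val \<zero>\<^bsub>fraction_semifield\<^esub> = Pinf"
    by (simp_all add: val_frac one_frac zero_frac one_neq_zero zero_extended_def)
next
  fix X Y assume X: "X \<in> carrier fraction_semifield" and Y: "Y \<in> carrier fraction_semifield"
  obtain a b where ab: "a \<in> carrier R" "b \<in> carrier R" "b \<noteq> \<zero>" "X = frac a b"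
    using frac_cases[OF X] .
  obtain c d where cd: "c \<in> carrier R" "d \<in> carrier R" "d \<noteq> \<zero>" "Y = frac c d"
    using frac_cases[OF Y] .
  show "val (X \<otimes>\<^bsub>fraction_semifield\<^esub> Y) = val X + val Y"
    "min (val X) (val Y) \<le> val (X \<oplus>\<^bsub>fraction_semifield\<^esub> Y)"
    using ab cd val_add[OF ab(1-3) cd(1-3)] by (simp_all add: mult_frac add_frac val_frac ord_mult)
qed

lemma val_surj: "val ` carrier fraction_semifield = Z_inf"
proof
  show "val ` carrier fraction_semifield \<subseteq> Z_inf" by (auto simp: val_def Z_inf_def)
  show "Z_inf \<subseteq> val ` carrier fraction_semifield"
  proof
    fix z assume "z \<in> Z_inf"
    then consider "z = Pinf" | k where "z = Fin k" by (auto simp: Z_inf_def)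
    then show "z \<in> val ` carrier fraction_semifield"
    proof cases
      case 1
      then show ?thesis
        by (intro image_eqI[of _ _ "frac \<zero> \<one>"]) (auto simp: val_frac frac_closed one_neq_zero)
    next
      case 2
      then show ?thesis
        by (intro image_eqI[of _ _ "frac (t [^] nat k) (t [^] nat (- k))"])
          (auto simp: val_frac frac_closed)
    qed
  qed
qed

text \<open>A nonzero fraction has nonnegative value precisely when its denominator divides its numerator,
  since divisibility is comparison of orders.\<close>

lemma nonneg_val_iff:
  assumes "a \<in> carrier R" "b \<in> carrier R" "b \<noteq> \<zero>"
  shows "0 \<le> val (frac a b) \<longleftrightarrow> (\<exists>s\<in>carrier R. frac a b = frac s \<one>)"
proof (cases "a = \<zero>")
  case True
  then show ?thesis using assms
    by (auto simp: val_frac frac_eq_iff one_neq_zero intro!: bexI[of _ \<zero>])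
next
  case False
  have "(\<exists>s\<in>carrier R. frac a b = frac s \<one>) \<longleftrightarrow> a \<in> generated_by R b"
    unfolding mem_generated_by using assms by (simp add: frac_eq_iff one_neq_zero)
  then show ?thesis using False assms
    by (simp add: val_frac divides_iff_ord zero_extended_def)
qed

lemma discrete_valuation: "discrete_valuation_semiring R"
proof (rule discrete_valuation_semiringI)
  have "(\<lambda>s. frac s \<one>) ` carrier R = {X \<in> carrier fraction_semifield. 0 \<le> val X}"
  proof (intro subset_antisym subsetI)
    fix X assume "X \<in> (\<lambda>s. frac s \<one>) ` carrier R"
    then show "X \<in> {X \<in> carrier fraction_semifield. 0 \<le> val X}"
      using nonneg_val_iff[OF _ one_closed one_neq_zero] frac_closed one_neq_zero by blast
  next
    fix X assume "X \<in> {X \<in> carrier fraction_semifield. 0 \<le> val X}"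
    then have X: "X \<in> carrier fraction_semifield" "0 \<le> val X" by auto
    obtain a b where "a \<in> carrier R" "b \<in> carrier R" "b \<noteq> \<zero>" "X = frac a b"
      using frac_cases[OF X(1)] .
    then show "X \<in> (\<lambda>s. frac s \<one>) ` carrier R" using nonneg_val_iff X(2) by blast
  qed
  then show "valuation_semiring_of R fraction_semifield (\<lambda>s. frac s \<one>) val"
    using semifield_fractions embedding_fractions valuation_fractions val_surj
    by (simp add: valuation_semiring_of_def)
qed (rule nontrivial_comm_semiring_axioms)

end

section \<open>Sources of uniformizers\<close>

context mc_semiring
begin

text \<open>When \<open>a\<close> has been divided by \<open>t\<close> as often as possible, the remaining cofactor lies outside the
  only maximal ideal and hence is a unit.  Separatedness says that the division ends.\<close>

lemma uniformizer_of_separated_maximal_ideal: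
  assumes max: "\<And>I. semiring_maximal_ideal R I \<longleftrightarrow> I = generated_by R t"
    and nonzero: "generated_by R t \<noteq> {\<zero>}" and t: "t \<in> carrier R"
    and separated: "\<And>a. a \<in> carrier R \<Longrightarrow> (\<And>n::nat. a \<in> generated_by R (t [^] n)) \<Longrightarrow> a = \<zero>"
  shows "uniformizer R t"
proof
  show "t \<noteq> \<zero>" using nonzero generated_by_zero by metis
  show "t \<notin> Units R"
    using max generated_by_proper_iff[OF t] by (auto simp: semiring_maximal_ideal_def)
  fix a assume a: "a \<in> carrier R" "a \<noteq> \<zero>"
  define m where "m = (LEAST n::nat. a \<notin> generated_by R (t [^] n))"
  have "\<exists>n::nat. a \<notin> generated_by R (t [^] n)" using separated[OF a(1)] a(2) by blast
  then have m: "a \<notin> generated_by R (t [^] m)" unfolding m_def by (rule LeastI_ex)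
  have "a \<in> generated_by R (t [^] (0::nat))" using a(1) by (auto simp: mem_generated_by)
  then have "m \<noteq> 0" using m by metis
  then obtain k where k: "m = Suc k" using not0_implies_Suc by blast
  then have "a \<in> generated_by R (t [^] k)" using not_less_Least[of k "\<lambda>n. a \<notin> generated_by R (t [^] n)"] unfolding m_def by simp
  then obtain s where s: "s \<in> carrier R" "a = s \<otimes> t [^] k" unfolding mem_generated_by by blast
  have "s \<in> Units R"
  proof (rule ccontr)
    assume "s \<notin> Units R"
    then have "s \<in> generated_by R t"
      using nonunit_in_unique_maximal[OF _ s(1)] max by blast
    then obtain r where "r \<in> carrier R" "s = r \<otimes> t" unfolding mem_generated_by by blast
    then have "a = r \<otimes> t [^] m" using s t by (simp add: k m_ac)
    then show False using m \<open>r \<in> carrier R\<close> unfolding mem_generated_by by blast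
  qed
  then show "\<exists>u\<in>Units R. \<exists>n::nat. a = u \<otimes> t [^] n" using s(2) by blast
qed (rule t)

text \<open>If a nonzero element could be divided by \<open>t\<close> forever, its successive quotients would generate
  a chain of principal ideals that ascends strictly, because \<open>t\<close> is not a unit.\<close>

lemma ACCP_imp_separated:
  assumes accp: "ACCP R" and t: "t \<in> carrier R" "t \<noteq> \<zero>" "t \<notin> Units R"
    and a: "\<And>n::nat. a \<in> generated_by R (t [^] n)"
  shows "a = \<zero>"
proof (rule ccontr)
  assume "a \<noteq> \<zero>"
  have "\<exists>c. c \<in> carrier R \<and> a = c \<otimes> t [^] n" for n :: nat
    using a[of n] unfolding mem_generated_by by blast
  then obtain c where c: "\<And>n::nat. c n \<in> carrier R" "\<And>n. a = c n \<otimes> t [^] n" by metis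
  have step: "c n = t \<otimes> c (Suc n)" for n
  proof -
    have "c n \<otimes> t [^] n = c (Suc n) \<otimes> t [^] Suc n" using c(2)[of n] c(2)[of "Suc n"] by metis
    also have "\<dots> = (t \<otimes> c (Suc n)) \<otimes> t [^] n" using c(1) t by (simp add: m_ac)
    finally show ?thesis using c(1) t pow_nonzero[of t n] by (simp add: m_rcancel)
  qed
  have "generated_by R (c n) \<subseteq> generated_by R (c (Suc n))" for n
  proof (rule generated_by_subset)
    show "c n \<in> generated_by R (c (Suc n))"
      unfolding mem_generated_by using step[of n] t(1) by blast
  qed (simp add: semiring_ideal_generated_by c)
  moreover have "semiring_principal R (generated_by R (c n))" for n
    using c(1) by (auto simp: semiring_principal_def)
  ultimately have "\<exists>N. \<forall>n\<ge>N. generated_by R (c n) = generated_by R (c N)"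
    using accp unfolding ACCP_def by (elim allE[of _ "\<lambda>n. generated_by R (c n)"]) simp
  then obtain N where "generated_by R (c (Suc N)) = generated_by R (c N)"
    using le_SucI by blast
  then have "c (Suc N) \<in> generated_by R (c N)" using self_in_generated_by c(1) by metis
  then obtain s where s: "s \<in> carrier R" "c (Suc N) = s \<otimes> c N"
    unfolding mem_generated_by by blast
  have nz: "c (Suc N) \<noteq> \<zero>"
  proof
    assume "c (Suc N) = \<zero>"
    then have "a = \<zero>" using c(2)[of "Suc N"] t(1) by simp
    then show False using \<open>a \<noteq> \<zero>\<close> by simp
  qed
  have "c (Suc N) \<otimes> \<one> = s \<otimes> (t \<otimes> c (Suc N))" using s(2) step[of N] c(1) by simp
  also have "\<dots> = c (Suc N) \<otimes> (t \<otimes> s)" using s(1) c(1) t(1) by (simp add: m_ac)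
  finally have "\<one> = t \<otimes> s" using nz s(1) c(1) t(1) by (subst (asm) m_lcancel) simp_all
  then have "t \<otimes> s \<in> Units R" by (metis Units_one_closed)
  then show False using Units_left_factor t s(1) by blast
qed

text \<open>In a cancellative semiring, two elements that generate the same principal ideal are
  associates; here these are a nonzero element and a power of \<open>t\<close>.\<close>

lemma uniformizer_of_ideals_powers:
  assumes t: "t \<in> carrier R" "t \<noteq> \<zero>" "t \<notin> Units R"
    and ideals: "\<And>I. semiring_ideal R I \<Longrightarrow> I \<noteq> {\<zero>} \<Longrightarrow> \<exists>n::nat. I = generated_by R (t [^] n)"
  shows "uniformizer R t"
proof
  fix a assume a: "a \<in> carrier R" "a \<noteq> \<zero>"
  have "generated_by R a \<noteq> {\<zero>}" using self_in_generated_by[OF a(1)] a(2) by auto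
  then obtain n :: nat where n: "generated_by R a = generated_by R (t [^] n)"
    using ideals[OF semiring_ideal_generated_by[OF a(1)]] by blast
  have "a \<in> generated_by R (t [^] n)" "t [^] n \<in> generated_by R a"
    using self_in_generated_by a(1) t(1) n by (metis, metis nat_pow_closed)
  then obtain r s where rs: "r \<in> carrier R" "s \<in> carrier R" "a = r \<otimes> t [^] n" "t [^] n = s \<otimes> a"
    unfolding mem_generated_by by blast
  have "a \<otimes> \<one> = r \<otimes> (s \<otimes> a)" using rs(3,4) a(1) by simp
  also have "\<dots> = a \<otimes> (r \<otimes> s)" using rs(1,2) a(1) by (simp add: m_ac)
  finally have "\<one> = r \<otimes> s" using a rs(1,2) by (subst (asm) m_lcancel) simp_all
  then have "r \<otimes> s \<in> Units R" by (metis Units_one_closed)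
  then have "r \<in> Units R" using Units_left_factor rs(1,2) by blast
  then show "\<exists>u\<in>Units R. \<exists>n::nat. a = u \<otimes> t [^] n" using rs(3) by blast
qed (use t in auto)

lemma uniformizer_of_unique_irreducible:
  assumes fact: "unique_factorization_semiring R" and t: "semiring_irreducible R t"
    and assoc: "\<And>s. semiring_irreducible R s \<Longrightarrow> semiring_associates R s t"
  shows "uniformizer R t"
proof
  have tc: "t \<in> carrier R" using t by (simp add: semiring_irreducible_def)
  show "t \<in> carrier R" "t \<noteq> \<zero>" "t \<notin> Units R" using t by (simp_all add: semiring_irreducible_def)
  fix a assume a: "a \<in> carrier R" "a \<noteq> \<zero>"
  have prod: "\<exists>u\<in>Units R. finprod R q {..<n} = u \<otimes> t [^] n"
    if "\<And>i. i < n \<Longrightarrow> semiring_irreducible R (q i)" for n :: nat and q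
    using that
  proof (induction n)
    case 0
    then show ?case by (intro bexI[of _ \<one>]) simp_all
  next
    case (Suc n)
    then obtain u where u: "u \<in> Units R" "finprod R q {..<n} = u \<otimes> t [^] n" by auto
    obtain w where w: "w \<in> Units R" "q n = w \<otimes> t"
      using assoc[OF Suc.prems[of n]] by (auto simp: semiring_associates_def)
    have "q \<in> {..<Suc n} \<rightarrow> carrier R" using Suc.prems by (auto simp: semiring_irreducible_def)
    then have "finprod R q {..<Suc n} = q n \<otimes> finprod R q {..<n}"
      by (simp add: lessThan_Suc Pi_def)
    also have "\<dots> = (w \<otimes> u) \<otimes> t [^] Suc n" using u w tc by (simp add: m_ac)
    finally show ?case using u(1) w(1) Units_m_closed by blast
  qed
  show "\<exists>u\<in>Units R. \<exists>n::nat. a = u \<otimes> t [^] n"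
  proof (cases "a \<in> Units R")
    case True
    then show ?thesis using a(1) by (intro bexI[of _ a] exI[of _ 0]) simp_all
  next
    case False
    then obtain n :: nat and q where "\<forall>i<n. semiring_irreducible R (q i)" "a = finprod R q {..<n}"
      using fact a unfolding unique_factorization_semiring_def by blast
    then show ?thesis using prod by blast
  qed
qed

end

context nontrivial_comm_semiring
begin

text \<open>Any element of value one is a uniformizer: dividing by it in \<open>K\<close> lowers the value by one, and
  the elements of value zero are units of \<open>R\<close>, because their inverses in \<open>K\<close> have value zero as well.\<close>

lemma uniformizer_of_discrete_valuation:
  assumes "discrete_valuation_semiring R"
  shows "\<exists>t. uniformizer R t"
proof -
  obtain K :: "('a \<times> 'a) ring" and f v where val: "valuation_semiring_of R K f v"
    using assms by (auto simp: discrete_valuation_semiring_def)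
  interpret K: semifield K using val by (simp add: valuation_semiring_of_def)
  have f_hom: "f \<in> ring_hom R K" and f_zero: "f \<zero> = \<zero>\<^bsub>K\<^esub>" and f_inj: "inj_on f (carrier R)"
    and dv: "discrete_valuation K v" and surj: "v ` carrier K = Z_inf"
    and img: "f ` carrier R = {x \<in> carrier K. 0 \<le> v x}"
    using val by (auto simp: valuation_semiring_of_def semiring_embedding_def)
  have f_closed: "f a \<in> carrier K" if "a \<in> carrier R" for a
    using f_hom that by (rule ring_hom_closed)
  have f_mult: "f (a \<otimes> b) = f a \<otimes>\<^bsub>K\<^esub> f b" if "a \<in> carrier R" "b \<in> carrier R" for a b
    using f_hom that by (rule ring_hom_mult)
  have f_one: "f \<one> = \<one>\<^bsub>K\<^esub>" using f_hom by (rule ring_hom_one)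
  have f_eq: "f a = f b \<longleftrightarrow> a = b" if "a \<in> carrier R" "b \<in> carrier R" for a b
    using f_inj that by (auto simp: inj_on_def)
  have f_Units: "f a \<in> Units K" if "a \<in> carrier R" "a \<noteq> \<zero>" for a
    using K.nonzero_Units f_closed[OF that(1)] f_eq[OF that(1) zero_closed] that(2) f_zero by auto
  have v_mult: "v (x \<otimes>\<^bsub>K\<^esub> y) = v x + v y" if "x \<in> carrier K" "y \<in> carrier K" for x y
    using dv that by (simp add: discrete_valuation_def)
  have v_one: "v \<one>\<^bsub>K\<^esub> = Fin 0" and v_zero: "v \<zero>\<^bsub>K\<^esub> = Pinf"
    using dv by (simp_all add: discrete_valuation_def zero_extended_def)
  have v_Fin: "\<exists>k. v x = Fin k \<and> v (inv\<^bsub>K\<^esub> x) = Fin (- k)" if x: "x \<in> Units K" for x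
  proof -
    have "v x + v (inv\<^bsub>K\<^esub> x) = Fin 0"
      using x v_mult[of x "inv\<^bsub>K\<^esub> x"] v_one K.Units_r_inv K.Units_closed K.Units_inv_closed by metis
    then show ?thesis by (cases "v x"; cases "v (inv\<^bsub>K\<^esub> x)") auto
  qed
  have in_image: "\<exists>s\<in>carrier R. f s = x" if "x \<in> carrier K" "0 \<le> v x" for x
  proof -
    have "x \<in> f ` carrier R" unfolding img using that by simp
    then show ?thesis by blast
  qed
  have v_nonneg: "0 \<le> v (f a)" if "a \<in> carrier R" for a using img that by blast

  have "mult_cancellative R"
    unfolding mult_cancellative_def
  proof (intro ballI impI, elim conjE)
    fix a b c assume abc: "a \<in> carrier R" "b \<in> carrier R" "c \<in> carrier R" "a \<otimes> b = a \<otimes> c" "a \<noteq> \<zero>"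
    then have "f a \<otimes>\<^bsub>K\<^esub> f b = f a \<otimes>\<^bsub>K\<^esub> f c" using f_mult by metis
    then have "f b = f c" using K.Units_l_cancel f_Units f_closed abc by simp
    then show "b = c" using f_eq abc by simp
  qed
  then interpret mc_semiring R by unfold_locales

  have unit: "a \<in> Units R" if a: "a \<in> carrier R" "a \<noteq> \<zero>" "v (f a) = Fin 0" for a
  proof -
    have "v (inv\<^bsub>K\<^esub> f a) = Fin 0" using v_Fin[OF f_Units[OF a(1,2)]] a(3) by auto
    then obtain b where b: "b \<in> carrier R" "f b = inv\<^bsub>K\<^esub> f a"
      using in_image[of "inv\<^bsub>K\<^esub> f a"] f_Units[OF a(1,2)] by (auto simp: zero_extended_def)
    then have "f (a \<otimes> b) = f \<one>" using f_mult a f_Units f_one by simp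
    then have "a \<otimes> b = \<one>" using f_eq[of "a \<otimes> b" \<one>] a b by simp
    then have "a \<otimes> b \<in> Units R" by simp
    then show ?thesis using Units_left_factor a b by blast
  qed

  have "Fin 1 \<in> v ` carrier K" unfolding surj by (simp add: Z_inf_def)
  then obtain x where x: "x \<in> carrier K" "v x = Fin 1" by auto
  obtain t where t: "t \<in> carrier R" "f t = x"
    using in_image[OF x(1)] x(2) by (auto simp: zero_extended_def)
  have t_nonzero: "t \<noteq> \<zero>" using t x v_zero f_zero by auto
  have factor: "\<exists>u\<in>Units R. a = u \<otimes> t [^] n"
    if "a \<in> carrier R" "a \<noteq> \<zero>" "v (f a) = Fin (int n)" for a n
    using that
  proof (induction n arbitrary: a)
    case 0
    then show ?case using unit[of a] by (intro bexI[of _ a]) simp_all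
  next
    case (Suc n)
    \<comment> \<open>The quotient of \<open>a\<close> by \<open>t\<close> in \<open>K\<close> has nonnegative value, so it lies in \<open>R\<close>.\<close>
    have x_Units: "x \<in> Units K" using f_Units[OF t(1) t_nonzero] t(2) by simp
    then have "v (inv\<^bsub>K\<^esub> x) = Fin (- 1)" using v_Fin[OF x_Units] x(2) by auto
    then have q: "v (f a \<otimes>\<^bsub>K\<^esub> inv\<^bsub>K\<^esub> x) = Fin (int n)"
      using Suc.prems f_closed x_Units by (simp add: v_mult)
    then obtain b where b: "b \<in> carrier R" "f b = f a \<otimes>\<^bsub>K\<^esub> inv\<^bsub>K\<^esub> x"
      using in_image[of "f a \<otimes>\<^bsub>K\<^esub> inv\<^bsub>K\<^esub> x"] f_closed Suc.prems(1) x_Units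
      by (auto simp: zero_extended_def)
    have "f (b \<otimes> t) = f a"
      using b t f_mult Suc.prems(1) f_closed x(1) x_Units by (simp add: K.m_assoc)
    then have a: "a = b \<otimes> t" using f_eq[of "b \<otimes> t" a] b(1) t(1) Suc.prems(1) by simp
    then have "b \<noteq> \<zero>" using Suc.prems(2) t(1) by auto
    then obtain u where "u \<in> Units R" "b = u \<otimes> t [^] n" using Suc.IH[OF b(1)] q b(2) by auto
    then show ?case using a t(1) by (intro bexI[of _ u]) (simp_all add: m_assoc)
  qed
  have "uniformizer R t"
  proof
    show "t \<notin> Units R"
    proof
      assume u: "t \<in> Units R"
      then have "v (f (inv t)) + Fin 1 = Fin 0"
        using v_mult[of "f (inv t)" "f t"] f_mult[of "inv t" t] f_closed t x f_one v_one by simp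
      moreover have "0 \<le> v (f (inv t))" using v_nonneg u by simp
      ultimately show False by (cases "v (f (inv t))") (auto simp: zero_extended_def)
    qed
  next
    fix a assume a: "a \<in> carrier R" "a \<noteq> \<zero>"
    obtain k where k: "v (f a) = Fin k" using v_Fin[OF f_Units[OF a]] by blast
    then have "v (f a) = Fin (int (nat k))"
      using v_nonneg[OF a(1)] by (simp add: zero_extended_def)
    then show "\<exists>u\<in>Units R. \<exists>n::nat. a = u \<otimes> t [^] n" using factor[OF a] by blast
  qed (rule t(1), rule t_nonzero)
  then show ?thesis ..
qed

lemma discrete_valuation_iff_uniformizer:
  "discrete_valuation_semiring R \<longleftrightarrow> (\<exists>t. uniformizer R t)"
proof
  assume "\<exists>t. uniformizer R t"
  then obtain t where "uniformizer R t" ..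
  then show "discrete_valuation_semiring R" by (rule uniformizer.discrete_valuation)
qed (rule uniformizer_of_discrete_valuation)

text \<open>Either finiteness condition rules out a nonzero element that is divisible by all powers of a
  generator of the maximal ideal.\<close>

lemma uniformizer_of_separated_local:
  assumes mc: "mult_cancellative R" and local: "quasi_local R" and J: "semiring_maximal_ideal R J"
    and nonzero: "J \<noteq> {\<zero>}" and principal: "semiring_principal R J"
    and separated: "ACCP R \<or> (\<Inter>n\<in>{1..}. semiring_ideal_power R J n) = {\<zero>}"
  shows "\<exists>t. uniformizer R t"
proof -
  interpret mc_semiring R by unfold_locales (rule mc)
  obtain t where t: "t \<in> carrier R" "J = generated_by R t"
    using principal by (auto simp: semiring_principal_def)
  have max: "semiring_maximal_ideal R I \<longleftrightarrow> I = generated_by R t" for I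
    using local J t(2) unfolding quasi_local_def by metis
  have t_nonzero: "t \<noteq> \<zero>" using nonzero t(2) generated_by_zero by metis
  have t_nonunit: "t \<notin> Units R"
    using J t generated_by_proper_iff[OF t(1)] by (simp add: semiring_maximal_ideal_def)
  have "a = \<zero>" if "\<And>n::nat. a \<in> generated_by R (t [^] n)" for a
    using separated
  proof
    assume "ACCP R"
    then show ?thesis using ACCP_imp_separated t(1) t_nonzero t_nonunit that by blast
  next
    assume "(\<Inter>n\<in>{1..}. semiring_ideal_power R J n) = {\<zero>}"
    moreover have "a \<in> (\<Inter>n\<in>{1..}. semiring_ideal_power R J n)"
      using that ideal_power_generated_by[OF t(1)] t(2) by simp
    ultimately show ?thesis by simp
  qed
  then have "uniformizer R t"
    using uniformizer_of_separated_maximal_ideal[OF max] nonzero t by simp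
  then show ?thesis ..
qed

end

theorem theorem4p6:
  fixes S :: "('a, 'm) ring_scheme"
  assumes "nontrivial_comm_semiring S"
  shows
   "(discrete_valuation_semiring S \<longleftrightarrow>
       principal_ideal_semiring S \<and> mult_cancellative S \<and>
       (\<exists>J. (\<forall>I. semiring_maximal_ideal S I \<longleftrightarrow> I = J) \<and> J \<noteq> {\<zero>\<^bsub>S\<^esub>})) \<and>
    (discrete_valuation_semiring S \<longleftrightarrow>
       unique_factorization_semiring S \<and>
       (\<exists>t. semiring_irreducible S t \<and>
            (\<forall>s. semiring_irreducible S s \<longrightarrow> semiring_associates S s t))) \<and>
    (discrete_valuation_semiring S \<longleftrightarrow>
       quasi_local S \<and> mult_cancellative S \<and>
       (\<exists>J. semiring_maximal_ideal S J \<and> J \<noteq> {\<zero>\<^bsub>S\<^esub>} \<and> semiring_principal S J \<and>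
            (\<Inter>n\<in>{1..}. semiring_ideal_power S J n) = {\<zero>\<^bsub>S\<^esub>})) \<and>
    (discrete_valuation_semiring S \<longleftrightarrow>
       quasi_local S \<and> mult_cancellative S \<and> ACCP S \<and>
       (\<exists>J. semiring_maximal_ideal S J \<and> J \<noteq> {\<zero>\<^bsub>S\<^esub>} \<and> semiring_principal S J)) \<and>
    (discrete_valuation_semiring S \<longleftrightarrow>
       mult_cancellative S \<and>
       (\<exists>t\<in>carrier S. t \<noteq> \<zero>\<^bsub>S\<^esub> \<and> t \<notin> Units S \<and>
          (\<forall>I. semiring_ideal S I \<and> I \<noteq> {\<zero>\<^bsub>S\<^esub>} \<longrightarrow>
               (\<exists>n :: nat. I = generated_by S (t [^]\<^bsub>S\<^esub> n)))))"
proof -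
  interpret nontrivial_comm_semiring S by (rule assms)
  let ?U = "\<exists>t. uniformizer S t"
  have U_imp: "principal_ideal_semiring S \<and> mult_cancellative S \<and> quasi_local S \<and> ACCP S \<and>
      unique_factorization_semiring S" if U: ?U
  proof -
    obtain t where "uniformizer S t" using U ..
    then interpret uniformizer S t .
    show ?thesis
      using principal_ideals principal_ideal_semiring_ACCP mult_cancellative unique_factorization
      by (simp add: quasi_local_def maximal_ideal_iff)
  qed
  have pis: "?U \<longleftrightarrow> principal_ideal_semiring S \<and> mult_cancellative S \<and>
      (\<exists>J. (\<forall>I. semiring_maximal_ideal S I \<longleftrightarrow> I = J) \<and> J \<noteq> {\<zero>\<^bsub>S\<^esub>})" (is "_ \<longleftrightarrow> ?R")
  proof
    assume ?U
    then show ?R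
      using U_imp uniformizer.maximal_ideal_iff uniformizer.generated_by_t_nonzero by metis
  next
    assume R: ?R
    then obtain J where J: "\<And>I. semiring_maximal_ideal S I \<longleftrightarrow> I = J" "J \<noteq> {\<zero>\<^bsub>S\<^esub>}" by blast
    have "semiring_principal S J"
      using R J(1) unfolding principal_ideal_semiring_def semiring_maximal_ideal_def by blast
    moreover have "quasi_local S" unfolding quasi_local_def J(1) by simp
    moreover have "ACCP S" using R principal_ideal_semiring_ACCP by simp
    moreover have "mult_cancellative S" using R by simp
    ultimately show ?U using J by (intro uniformizer_of_separated_local[of J]) simp_all
  qed
  have ufs: "?U \<longleftrightarrow> unique_factorization_semiring S \<and>
      (\<exists>t. semiring_irreducible S t \<and>
           (\<forall>s. semiring_irreducible S s \<longrightarrow> semiring_associates S s t))" (is "_ \<longleftrightarrow> ?R")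
  proof
    assume U: ?U
    then obtain t where "uniformizer S t" ..
    then interpret uniformizer S t .
    have "semiring_irreducible S t" using irreducible_iff_ord[of t] ord_pow_t[of 1] by simp
    then show ?R using associates_t unique_factorization by blast
  next
    assume R: ?R
    then interpret mc_semiring S
      by unfold_locales (simp add: unique_factorization_semiring_def)
    show ?U using R uniformizer_of_unique_irreducible by blast
  qed
  have sep: "?U \<longleftrightarrow> quasi_local S \<and> mult_cancellative S \<and>
      (\<exists>J. semiring_maximal_ideal S J \<and> J \<noteq> {\<zero>\<^bsub>S\<^esub>} \<and> semiring_principal S J \<and>
           (\<Inter>n\<in>{1..}. semiring_ideal_power S J n) = {\<zero>\<^bsub>S\<^esub>})" (is "_ \<longleftrightarrow> ?R")
  proof
    assume U: ?U
    then obtain t where "uniformizer S t" ..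
    then interpret uniformizer S t .
    have "semiring_principal S (generated_by S t)"
      unfolding semiring_principal_def using t_closed by blast
    then show ?R
      using U_imp[OF U] maximal_ideal_iff generated_by_t_nonzero Inter_powers by blast
  next
    assume ?R
    then show ?U using uniformizer_of_separated_local by blast
  qed
  have accp: "?U \<longleftrightarrow> quasi_local S \<and> mult_cancellative S \<and> ACCP S \<and>
      (\<exists>J. semiring_maximal_ideal S J \<and> J \<noteq> {\<zero>\<^bsub>S\<^esub>} \<and> semiring_principal S J)" (is "_ \<longleftrightarrow> ?R")
  proof
    assume ?U
    then show ?R using U_imp sep by blast
  next
    assume ?R
    then show ?U using uniformizer_of_separated_local by blast
  qed
  have powers: "?U \<longleftrightarrow> mult_cancellative S \<and>
      (\<exists>t\<in>carrier S. t \<noteq> \<zero>\<^bsub>S\<^esub> \<and> t \<notin> Units S \<and>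
         (\<forall>I. semiring_ideal S I \<and> I \<noteq> {\<zero>\<^bsub>S\<^esub>} \<longrightarrow>
              (\<exists>n :: nat. I = generated_by S (t [^]\<^bsub>S\<^esub> n))))" (is "_ \<longleftrightarrow> ?R")
  proof
    assume ?U
    then obtain t where "uniformizer S t" ..
    then interpret uniformizer S t .
    show ?R
      using mult_cancellative t_closed t_nonzero t_nonunit nonzero_ideal_eq_power by blast
  next
    assume R: ?R
    then interpret mc_semiring S by unfold_locales simp
    obtain t where t: "t \<in> carrier S" "t \<noteq> \<zero>\<^bsub>S\<^esub>" "t \<notin> Units S"
      "\<forall>I. semiring_ideal S I \<and> I \<noteq> {\<zero>\<^bsub>S\<^esub>} \<longrightarrow> (\<exists>n::nat. I = generated_by S (t [^]\<^bsub>S\<^esub> n))"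
      using R by (elim conjE bexE)
    have "uniformizer S t"
    proof (rule uniformizer_of_ideals_powers[OF t(1-3)])
      fix I assume "semiring_ideal S I" "I \<noteq> {\<zero>\<^bsub>S\<^esub>}"
      then show "\<exists>n::nat. I = generated_by S (t [^]\<^bsub>S\<^esub> n)" using t(4) by simp
    qed
    then show ?U ..
  qed
  show ?thesis
    unfolding discrete_valuation_iff_uniformizer
    by (intro conjI; rule pis ufs sep accp powers)
qed

end
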